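(* Let $A\sim\mathrm{SBM}(y,z,P)$ be an $n\times m$ bipartite stochastic block model with $K$ row and $L$ column clusters. Fix any column label vector $\tilde z\in[L]^m$, let $b_{i\ell}=\sum_{j=1}^mA_{ij}1\{\tilde z_j=\ell\}$, $b_{i*}=(b_{i1},\dots,b_{iL})$, and let $\Lambda'=\Lambda(y,\tilde z)$ be the associated row mean parameter matrix. Assume (A1) $\frac{\|\Lambda\|_\infty}{\Lambda_{\min}}\vee\frac{\|\Gamma\|_\infty}{\Gamma_{\min}}\le\omega$; (A2) $\frac1{\beta K}\le\pi_k(y)\le\frac\beta K$ and $\frac1{\beta L}\le\pi_\ell(z)\le\frac\beta L$ for all $k\in[K],\ell\in[L]$; and $\Lambda'\in\mathscr B_\Lambda(\delta)$ with $3\omega\delta<1$. Then for all $k,r\in[K]$ with $k\ne r$, and all $i$ with $y_i=k$: (a) With $\eta'=8\omega\delta L\|\Lambda\|_\infty$, $$P\big(\exists\tilde\Lambda\in\mathscr B_\Lambda(\delta):\ Y_{ikr}(b_{i*},\tilde\Lambda)\ge0\big)\le\exp(-I_{kr}+\eta').$$ (b) If in addition $\varepsilon_{kr}-2\omega(1+\varepsilon_{kr})\delta>0$, then with $$\eta_{kr}=21\,\delta\omega L\|\Lambda\|_\infty+\frac{5\beta L^2\|\Lambda\|_\infty^2}{m}+\log\Big[11\,\omega\Big(\frac1{\varepsilon_{kr}-2\omega(1+\varepsilon_{kr})\delta}+1\Big)\Big]-\frac12\log\Lambda_{\min},$$ $$P\big(\exists\tilde\Lambda\in\mathscr B_\Lambda(\delta):\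 Y_{ikr}(b_{i*},\tilde\Lambda)\ge0\big)\le\exp(-I_{kr}+\eta_{kr}).$$
   Context: $A\sim\mathrm{SBM}(y,z,P)$: $y\in[K]^n$, $z\in[L]^m$, $P\in[0,1]^{K\times L}$ deterministic and the entries $A_{ij}$ independent Bernoulli with mean $P_{y_iz_j}$. $n_k(y)=|\{i:y_i=k\}|$, $\pi_k(y)=n_k(y)/n$, $n_\ell(z)=|\{j:z_j=\ell\}|$, $\pi_\ell(z)=n_\ell(z)/m$. $\Lambda=(\lambda_{k\ell})\in\mathbb R_+^{K\times L}$ with $\lambda_{k\ell}=P_{k\ell}n_\ell(z)$; $\Gamma=(\Gamma_{\ell k})$ with $\Gamma_{\ell k}=n_k(y)P_{k\ell}$. $\|\cdot\|_\infty$ is the maximum absolute entry; $\Lambda_{\min},\Gamma_{\min}$ are minimum entries. $\Lambda(y,\tilde z)\in\mathbb R_+^{K\times L}$ has entries $\lambda_{k\ell}(y,\tilde z)=\frac1{n_k(y)}\sum_{i,j}E[A_{ij}]1\{y_i=k,\tilde z_j=\ell\}$ (so $E[b_{i\ell}]=\lambda_{k\ell}(y,\tilde z)$ if $y_i=k$). $\mathscr B_\Lambda(\delta)=\{\tilde\Lambda\in\mathbb R_+^{K\times L}:\|\tilde\Lambda-\Lambda\|_\infty\le\delta\|\Lambda\|_\infty\}$. For $\tilde\Lambda=(\tilde\lambda_{k\ell})$, $$Y_{ikr}(b_{i*},\tilde\Lambda)=\sum_{\ell=1}^L\Big[b_{i\ell}\log\frac{\tilde\lambda_{r\ell}}{\tilde\lambda_{k\ell}}+\tilde\lambda_{k\ell}-\tilde\lambda_{r\ell}\Big].$$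 $I_{kr}=\sup_{s\in(0,1)}\sum_{\ell=1}^L\big[(1-s)\lambda_{k\ell}+s\lambda_{r\ell}-\lambda_{k\ell}^{1-s}\lambda_{r\ell}^s\big]$ and $\varepsilon_{kr}=\max_\ell\max\big(\frac{\lambda_{k\ell}}{\lambda_{r\ell}},\frac{\lambda_{r\ell}}{\lambda_{k\ell}}\big)-1$. *)

theory Defs
  imports "HOL-Probability.Probability"
begin

text \<open>
  The index sets of sizes $n$, $m$, $K$, $L$ are finite types, so that $K$ is \<open>CARD('k)\<close> and so on,
  and all sizes are at least 1.  A $K \times L$ matrix has type \<open>real^'l^'k\<close>, its
  $(k,l)$ entry being \<open>X $ k $ l\<close>.
\<close>

text \<open>The 0/1 entries of the random matrix are booleans; \<^const>\<open>of_bool\<close> turns them into numbers.\<close>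

definition sbm ::
  "'w measure \<Rightarrow> ('n::finite \<Rightarrow> 'm::finite \<Rightarrow> 'w \<Rightarrow> bool) \<Rightarrow>
   ('n \<Rightarrow> 'k::finite) \<Rightarrow> ('m \<Rightarrow> 'l::finite) \<Rightarrow> real^'l^'k \<Rightarrow> bool" where
  "sbm M A y z P \<longleftrightarrow>
     prob_space M \<and>
     (\<forall>k l. 0 \<le> P $ k $ l \<and> P $ k $ l \<le> 1) \<and>
     prob_space.indep_vars M (\<lambda>_. count_space UNIV) (\<lambda>(i, j). A i j) UNIV \<and>
     (\<forall>i j. distr M (count_space UNIV) (A i j) = measure_pmf (bernoulli_pmf (P $ y i $ z j)))"

definition cluster_size :: "('i::finite \<Rightarrow> 'c) \<Rightarrow> 'c \<Rightarrow> nat" where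
  "cluster_size y c = card {i. y i = c}"

definition cluster_prop :: "('i::finite \<Rightarrow> 'c) \<Rightarrow> 'c \<Rightarrow> real" where
  "cluster_prop y c = real (cluster_size y c) / real CARD('i)"

definition max_norm :: "real^'b::finite^'a::finite \<Rightarrow> real" where
  "max_norm X = Max {\<bar>X $ a $ b\<bar> | a b. True}"

definition min_entry :: "real^'b::finite^'a::finite \<Rightarrow> real" where
  "min_entry X = Min {X $ a $ b | a b. True}"

definition Lambda_mat :: "('m::finite \<Rightarrow> 'l::finite) \<Rightarrow> real^'l^'k::finite \<Rightarrow> real^'l^'k" where
  "Lambda_mat z P = (\<chi> k l. P $ k $ l * real (cluster_size z l))"

definition Gamma_mat :: "('n::finite \<Rightarrow> 'k::finite) \<Rightarrow> real^'l::finite^'k \<Rightarrow> real^'k^'l" where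
  "Gamma_mat y P = (\<chi> l k. real (cluster_size y k) * P $ k $ l)"

definition row_mean_mat ::
  "'w measure \<Rightarrow> ('n::finite \<Rightarrow> 'm::finite \<Rightarrow> 'w \<Rightarrow> bool) \<Rightarrow>
   ('n \<Rightarrow> 'k::finite) \<Rightarrow> ('m \<Rightarrow> 'l::finite) \<Rightarrow> real^'l^'k" where
  "row_mean_mat M A y zt =
     (\<chi> k l. 1 / real (cluster_size y k) *
        (\<Sum>i\<in>UNIV. \<Sum>j\<in>UNIV.
           integral\<^sup>L M (\<lambda>w. of_bool (A i j w)) * of_bool (y i = k \<and> zt j = l)))"

definition mat_ball :: "real^'l::finite^'k::finite \<Rightarrow> real \<Rightarrow> (real^'l^'k) set" where
  "mat_ball \<Lambda> \<delta> =
     {X. (\<forall>k l. 0 \<le> X $ k $ l) \<and> max_norm (X - \<Lambda>) \<le> \<delta> * max_norm \<Lambda>}"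

definition block_sums ::
  "('n::finite \<Rightarrow> 'm::finite \<Rightarrow> 'w \<Rightarrow> bool) \<Rightarrow> ('m \<Rightarrow> 'l::finite) \<Rightarrow> 'n \<Rightarrow> 'w \<Rightarrow> real^'l" where
  "block_sums A zt i w = (\<chi> l. \<Sum>j\<in>UNIV. of_bool (A i j w) * of_bool (zt j = l))"

definition Y_stat :: "'k::finite \<Rightarrow> 'k \<Rightarrow> real^'l::finite \<Rightarrow> real^'l^'k \<Rightarrow> real" where
  "Y_stat k r b X =
     (\<Sum>l\<in>UNIV. b $ l * ln (X $ r $ l / X $ k $ l) + X $ k $ l - X $ r $ l)"

definition info :: "real^'l::finite^'k::finite \<Rightarrow> 'k \<Rightarrow> 'k \<Rightarrow> real" where
  "info \<Lambda> k r =
     (SUP s\<in>{0<..<1}. \<Sum>l\<in>UNIV.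
        (1 - s) * \<Lambda> $ k $ l + s * \<Lambda> $ r $ l
        - (\<Lambda> $ k $ l) powr (1 - s) * (\<Lambda> $ r $ l) powr s)"

definition eps_sep :: "real^'l::finite^'k::finite \<Rightarrow> 'k \<Rightarrow> 'k \<Rightarrow> real" where
  "eps_sep \<Lambda> k r =
     (MAX l. max (\<Lambda> $ k $ l / \<Lambda> $ r $ l) (\<Lambda> $ r $ l / \<Lambda> $ k $ l)) - 1"

end

theory Submission
  imports Defs
begin

text \<open>
  Fix the row \<open>i\<close> with \<open>y i = k\<close>, and let \<open>\<rho> = \<omega> * \<delta> < 1 / 3\<close>.  Because the entries of \<open>\<Lambda>\<close> differ at most by
  the factor \<open>\<omega>\<close>, every matrix of the ball is within relative error \<open>\<rho>\<close> of \<open>\<Lambda>\<close>.  So the existence of a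
  matrix of the ball with nonnegative statistic forces one linear statistic of the row to be
  nonnegative, namely the log-likelihood ratio with all ratios inflated by \<open>(1 + \<rho>) / (1 - \<rho>)\<close>
  (lemma \<open>misclassification_prob_le\<close>).  The row is a vector of independent Bernoulli variables whose
  expected block sums are within \<open>\<delta> * max_norm \<Lambda>\<close> of row \<open>k\<close> of \<open>\<Lambda>\<close>.

  For the first bound, the Chernoff inequality at a tilt \<open>s\<close> gives the exponent
  \<open>- f s\<close>, where \<open>f\<close> is the function whose supremum is \<^const>\<open>info\<close>, up to \<open>8 * \<rho> * max_norm \<Lambda>\<close> for each
  column cluster (\<open>sum_columns_exponent_le\<close>).  This holds for all \<open>s\<close> in the unit interval.

  For the second bound, a factor of order \<open>1 / sqrt (min_entry \<Lambda>)\<close> is gained in the manner of Bahadur and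
  Rao.  In the column cluster with the largest log-ratio, the number of successes is dominated by
  a Poisson law with a slightly larger mean (\<open>bernoulli_count_le_poisson\<close>).  The larger mean produces the
  term \<open>5 * \<beta> * L\<^sup>2 * (max_norm \<Lambda>)\<^sup>2 / m\<close>, where \<open>m\<close> is the number of columns and \<open>L\<close> that of their
  clusters, because balanced column clusters make every success probability at most
  \<open>\<beta> * L * max_norm \<Lambda> / m\<close>.  The
  masses of a Poisson law of mean \<open>\<mu>\<close> are at most \<open>1 / sqrt \<mu>\<close> (\<open>poisson_mass_le\<close>), and the tilted event
  collects them with geometrically decaying weights, at a total cost of at most
  \<open>1 + 1 / (s * \<bar>\<theta>\<bar>)\<close> with the log-ratio \<open>\<theta>\<close> of that cluster (\<open>bernoulli_sharp_chernoff\<close>).  This cost is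
  controlled only if \<open>s\<close> is not too small.  That is harmless, because \<open>f\<close> increases up to
  \<open>1 / (2 + ln (1 + eps_sep \<Lambda> k r))\<close> and so smaller tilts do not contribute to its supremum
  (\<open>mult_exp_le_exp_minus_one\<close>, \<open>info_le\<close>).
\<close>

section \<open>Exponential inequalities\<close>

lemma mult_exp_half_le: "u * exp (u / 2) \<le> exp u - 1" if "0 \<le> u" for u :: real
proof -
  have "u / 2 \<le> (exp (u / 2) - inverse (exp (u / 2))) / 2"
    using that by (intro real_le_x_sinh) auto
  then have "u * exp (u / 2) \<le> (exp (u / 2) - inverse (exp (u / 2))) * exp (u / 2)"
    by (intro mult_right_mono) auto
  also have "\<dots> = exp (u / 2) * exp (u / 2) - 1" by (simp add: algebra_simps)
  also have "\<dots> = exp u - 1" by (simp flip: exp_add)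
  finally show ?thesis .
qed

text \<open>
  This is \<open>tanh x \<le> x\<close> at \<open>x = v / 2\<close>, in the multiplied-out form needed for negative log-ratios; the
  previous lemma is \<open>sinh x \<ge> x\<close>.
\<close>

lemma one_minus_exp_le: "(1 - exp (- v)) * (1 + v / 2) \<le> v" if "0 \<le> v" for v :: real
proof -
  let ?h = "\<lambda>v::real. v - 2 + (v + 2) * exp (- v)"
  have "?h 0 \<le> ?h v"
  proof (rule DERIV_nonneg_imp_nondecreasing[OF that])
    fix x :: real assume "0 \<le> x" "x \<le> v"
    have "1 + x \<le> exp x" by simp
    then have "(1 + x) * exp (- x) \<le> exp x * exp (- x)" by (intro mult_right_mono) auto
    then have "0 \<le> 1 - (1 + x) * exp (- x)" by (simp flip: exp_add)
    moreover have "(?h has_real_derivative 1 - (1 + x) * exp (- x)) (at x)"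
      by (auto intro!: derivative_eq_intros simp: algebra_simps)
    ultimately show "\<exists>d. (?h has_real_derivative d) (at x) \<and> 0 \<le> d" by blast
  qed
  then show ?thesis by (simp add: field_simps)
qed

text \<open>
  The derivative in \<open>s\<close> of \<open>(1 - s) + s * exp u - exp (s * u)\<close> is \<open>exp u - 1 - u * exp (s * u)\<close>.  So the
  lemma says that the Chernoff exponent of a Poisson pair with log-ratio \<open>u\<close> still increases at
  every tilt \<open>s \<le> 1 / (2 + \<bar>u\<bar>)\<close>.  For \<open>u \<ge> 0\<close> this holds up to \<open>s = 1 / 2\<close>; for \<open>u = - v < 0\<close> the critical
  tilt is \<open>ln (v / (1 - exp (- v))) / v\<close>, which is at least \<open>ln (1 + v / 2) / v\<close>.
\<close>

lemma mult_exp_le_exp_minus_one: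
  fixes u s :: real
  assumes "0 \<le> s" and "s \<le> 1 / (2 + \<bar>u\<bar>)"
  shows "u * exp (s * u) \<le> exp u - 1"
proof (cases "0 \<le> u")
  case True
  have "s \<le> 1 / 2" using assms(2) by (rule order_trans) (simp add: field_simps)
  then have "s * u \<le> u / 2" using mult_right_mono[of s "1/2" u] True by simp
  then have "u * exp (s * u) \<le> u * exp (u / 2)" using True by (intro mult_left_mono) auto
  then show ?thesis using mult_exp_half_le[OF True] by simp
next
  case False
  define v where "v = - u"
  have v: "0 < v" "u = - v" using False by (auto simp: v_def)
  have "s * v \<le> v / (2 + v)"
    using mult_right_mono[OF assms(2), of v] v by simp
  also have "\<dots> \<le> ln (1 + v / 2)"
  proof -
    have "ln (1 + v / 2) = - ln (inverse (1 + v / 2))" using v by (subst ln_inverse) auto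
    moreover have "ln (inverse (1 + v / 2)) \<le> inverse (1 + v / 2) - 1"
      using v by (intro ln_le_minus_one) auto
    moreover have "1 - inverse (1 + v / 2) = v / (2 + v)" using v by (simp add: field_simps)
    ultimately show ?thesis by linarith
  qed
  finally have "exp (s * v) \<le> 1 + v / 2" using v by (subst (asm) ln_ge_iff) auto
  then have "(1 - exp (- v)) * exp (s * v) \<le> (1 - exp (- v)) * (1 + v / 2)"
    using v by (intro mult_left_mono) auto
  also have "\<dots> \<le> v" using one_minus_exp_le v by simp
  finally have "(1 - exp (- v)) * exp (s * v) * exp (- (s * v)) \<le> v * exp (- (s * v))"
    by (intro mult_right_mono) auto
  then have "1 - exp (- v) \<le> v * exp (- (s * v))" by (simp add: mult.assoc flip: exp_add)
  then show ?thesis using v by simp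
qed

section \<open>Point masses of the Poisson distribution\<close>

text \<open>
  A Stirling bound whose error term has the shift \<open>x + 1\<close> under the root, so that it holds from
  \<open>x = 0\<close> on and the ratio of the two sides is monotone.  The induction step asks for
  \<open>x * ln (1 + 1 / x) + ln (1 + 1 / (x + 1)) / 2 \<le> 1\<close>: the first summand is at most
  \<open>sqrt (x / (x + 1)) \<le> 1 - 1 / (2 * (x + 1))\<close> by the inequality \<open>sinh x \<ge> x\<close>, and the second is at
  most \<open>1 / (2 * (x + 1))\<close>.
\<close>

lemma fact_ge_sqrt_Suc_mult_power:
  "sqrt (real x + 1) * (real x / exp 1) ^ x \<le> fact x"
proof (induction x)
  case (Suc x)
  show ?case
  proof (cases "x = 0")
    case True
    have "sqrt 2 \<le> exp (1::real)"
    proof -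
      have "sqrt 2 \<le> 2" by (rule real_le_lsqrt) auto
      also have "2 \<le> exp (1::real)" using exp_ge_add_one_self[of 1] by simp
      finally show ?thesis .
    qed
    then show ?thesis using True by (simp add: field_simps)
  next
    case False
    define q where "q = real x"
    have q: "q > 0" using False by (simp add: q_def)
    define u where "u = ln ((q + 1) / q)"
    have u: "0 \<le> u" "exp u = (q + 1) / q" using q by (auto simp: u_def field_simps)
    have eh: "exp (u / 2) = sqrt ((q + 1) / q)"
      using u q by (intro real_sqrt_unique[symmetric]) (auto simp: power2_eq_square simp flip: exp_add)
    have "q * (u * exp (u / 2)) \<le> q * (exp u - 1)"
      using mult_exp_half_le[OF u(1)] q by (intro mult_left_mono) auto
    also have "\<dots> = 1" using q u by (simp add: field_simps)
    finally have "q * u \<le> exp (- (u / 2))"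
      by (simp add: exp_minus field_simps)
    also have "exp (- (u / 2)) = sqrt (1 - 1 / (q + 1))"
      using q by (simp add: exp_minus eh flip: real_sqrt_inverse) (simp add: field_simps)
    also have "\<dots> \<le> 1 - 1 / (2 * (q + 1))"
    proof -
      define a where "a = 1 / (q + 1)"
      have a: "0 < a" "a \<le> 1" "1 / (2 * (q + 1)) = a / 2" using q by (auto simp: a_def)
      have "1 - a \<le> (1 - a / 2)\<^sup>2" by (simp add: power2_eq_square algebra_simps)
      then have "sqrt (1 - a) \<le> 1 - a / 2" using a by (intro real_le_lsqrt) auto
      then show ?thesis unfolding a(3) unfolding a_def .
    qed
    finally have qu: "q * u \<le> 1 - 1 / (2 * (q + 1))" .
    have "ln (sqrt ((q + 2) / (q + 1))) = ln ((q + 2) / (q + 1)) / 2"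
      using q by (intro ln_sqrt) auto
    also have "\<dots> \<le> ((q + 2) / (q + 1) - 1) / 2"
      using q by (intro divide_right_mono ln_le_minus_one) auto
    also have "\<dots> = 1 / (2 * (q + 1))" using q by (simp add: field_simps)
    finally have "q * u + ln (sqrt ((q + 2) / (q + 1))) \<le> 1" using qu by linarith
    then have "exp (q * u + ln (sqrt ((q + 2) / (q + 1)))) \<le> exp 1" by simp
    then have *: "((q + 1) / q) ^ x * sqrt ((q + 2) / (q + 1)) \<le> exp 1"
      using q by (simp add: exp_add q_def[symmetric] u(2)[symmetric] exp_of_nat_mult[symmetric])
    have "sqrt (real (Suc x) + 1) * (real (Suc x) / exp 1) ^ Suc x
        = (sqrt (q + 1) * (q / exp 1) ^ x)
          * ((((q + 1) / q) ^ x * sqrt ((q + 2) / (q + 1))) * (q + 1) / exp 1)"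
      using q by (simp add: q_def[symmetric] power_divide real_sqrt_divide field_simps)
    also have "\<dots> \<le> fact x * (exp 1 * (q + 1) / exp 1)"
      using Suc.IH * q by (intro mult_mono divide_right_mono mult_right_mono) (auto simp: q_def)
    also have "\<dots> = fact (Suc x)" by (simp add: q_def)
    finally show ?thesis .
  qed
qed simp

text \<open>
  For \<open>x \<ge> \<mu> - 1\<close> the Stirling bound suffices, because \<open>(\<mu> * exp 1 / x) ^ x\<close> never exceeds \<open>exp \<mu>\<close>.
  Below the mode the masses increase with \<open>x\<close>, so a smaller \<open>x\<close> reduces to \<open>x = \<lfloor>\<mu>\<rfloor>\<close>.
\<close>

lemma poisson_mass_le:
  fixes \<mu> :: real
  assumes "0 < \<mu>"
  shows "\<mu> ^ x / fact x \<le> exp \<mu> / sqrt \<mu>"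
proof -
  have beyond: "\<mu> ^ x / fact x \<le> exp \<mu> / sqrt \<mu>" if "\<mu> \<le> real x + 1" for x
  proof -
    have s: "sqrt \<mu> \<le> sqrt (real x + 1)" using that by simp
    have "\<mu> ^ x \<le> exp \<mu> * (real x / exp 1) ^ x"
    proof (cases "x = 0")
      case False
      have "\<mu> / x \<le> exp (\<mu> / x - 1)" using exp_ge_add_one_self[of "\<mu> / x - 1"] by simp
      then have "(\<mu> / x) ^ x \<le> exp (\<mu> / x - 1) ^ x" using assms by (intro power_mono) auto
      also have "\<dots> = exp (\<mu> - x)"
        using False by (simp flip: exp_of_nat_mult add: right_diff_distrib)
      finally show ?thesis
        using False by (simp add: power_divide exp_diff field_simps flip: exp_of_nat_mult)
    qed (use assms in simp)
    then have "\<mu> ^ x * sqrt \<mu> \<le> (exp \<mu> * (real x / exp 1) ^ x) * sqrt (real x + 1)"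
      using s assms by (intro mult_mono) auto
    also have "\<dots> = exp \<mu> * (sqrt (real x + 1) * (real x / exp 1) ^ x)" by simp
    also have "\<dots> \<le> exp \<mu> * fact x"
      using fact_ge_sqrt_Suc_mult_power by (intro mult_left_mono) auto
    finally show ?thesis using assms by (simp add: field_simps)
  qed
  define N where "N = nat \<lfloor>\<mu>\<rfloor>"
  have N: "\<mu> \<le> real N + 1" "real N \<le> \<mu>" using assms unfolding N_def by linarith+
  show ?thesis
  proof (cases "x \<le> N")
    case True
    have "\<mu> ^ x / fact x \<le> \<mu> ^ N / fact N"
      using True
    proof (induction rule: inc_induct)
      case (step n)
      have "real n + 1 \<le> \<mu>" using step(2) N by linarith
      then have "\<mu> ^ n / fact n * 1 \<le> \<mu> ^ n / fact n * (\<mu> / (real n + 1))"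
        using assms by (intro mult_left_mono) auto
      also have "\<dots> = \<mu> ^ Suc n / fact (Suc n)" by (simp add: field_simps)
      finally show ?case using step(3) by simp
    qed simp
    then show ?thesis using beyond[OF N(1)] by linarith
  next
    case False
    then show ?thesis using N by (intro beyond) linarith
  qed
qed

section \<open>Tails of sums of independent indicators\<close>

text \<open>
  The points of the half-line \<open>a * x \<ge> - w\<close> are, seen from the one closest to the boundary, at distinct
  integer distances, so the sum is dominated by a geometric series.\<close>

lemma sum_exp_halfline_le:
  fixes a w :: real and X :: "nat set"
  assumes "finite X" and "a \<noteq> 0"
  shows "(\<Sum>x | x \<in> X \<and> 0 \<le> a * x + w. exp (- (a * x))) \<le> exp w / (1 - exp (- \<bar>a\<bar>))"
proof -
  define S where "S = {x \<in> X. 0 \<le> a * x + w}"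
  define r where "r = exp (- \<bar>a\<bar>)"
  have r: "0 < r" "r < 1" using assms by (auto simp: r_def)
  show ?thesis
  proof (cases "S = {}")
    case True
    then show ?thesis using r by (simp add: S_def[symmetric] r_def[symmetric])
  next
    case False
    have "finite S" using assms by (simp add: S_def)
    then have "Min ((\<lambda>x. a * real x) ` S) \<in> (\<lambda>x. a * real x) ` S"
      using False by (intro Min_in) auto
    then obtain x0 where x0: "x0 \<in> S" "Min ((\<lambda>x. a * real x) ` S) = a * x0" by blast
    then have min: "a * x0 \<le> a * x" if "x \<in> S" for x
      using \<open>finite S\<close> that by (metis Min_le finite_imageI imageI)
    define d where "d x = nat \<bar>int x - int x0\<bar>" for x
    have ad: "a * x = a * x0 + \<bar>a\<bar> * d x" if "x \<in> S" for x
    proof -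
      have "a * real x - a * real x0 = \<bar>a * (real x - real x0)\<bar>"
        using min[OF that] by (simp add: right_diff_distrib)
      also have "\<dots> = \<bar>a\<bar> * d x" by (simp add: abs_mult d_def)
      finally show ?thesis by simp
    qed
    have inj: "inj_on d S"
    proof (rule inj_onI)
      fix x y assume "x \<in> S" "y \<in> S" "d x = d y"
      then have "a * x = a * y" using ad by simp
      then show "x = y" using assms by simp
    qed
    have "(\<Sum>x\<in>S. exp (- (a * x))) = (\<Sum>x\<in>S. exp (- (a * x0)) * r ^ d x)"
      by (intro sum.cong refl) (simp add: ad r_def exp_add[symmetric] exp_of_nat_mult[symmetric])
    also have "\<dots> = exp (- (a * x0)) * (\<Sum>i\<in>d ` S. r ^ i)"
      using inj by (simp add: sum.reindex sum_distrib_left)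
    also have "\<dots> \<le> exp w * (1 / (1 - r))"
    proof (intro mult_mono)
      show "exp (- (a * x0)) \<le> exp w" using x0(1) by (simp add: S_def)
      have "(\<Sum>i\<in>d ` S. r ^ i) \<le> (\<Sum>i. r ^ i)"
        using r \<open>finite S\<close> by (intro sum_le_suminf summable_geometric) auto
      also have "\<dots> = 1 / (1 - r)" using r by (intro suminf_geometric) auto
      finally show "(\<Sum>i\<in>d ` S. r ^ i) \<le> 1 / (1 - r)" .
    qed (use r in \<open>auto intro!: sum_nonneg\<close>)
    finally show ?thesis by (simp add: S_def r_def)
  qed
qed

text \<open>
  Maclaurin's bound on the elementary symmetric polynomials: expanding the \<open>x\<close>-th power of the sum
  produces each product over an \<open>x\<close>-element set \<open>fact x\<close> times.
\<close>

lemma sum_prod_subsets_card_le: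
  fixes q :: "'a \<Rightarrow> real"
  assumes "finite J" and "\<And>j. j \<in> J \<Longrightarrow> 0 \<le> q j"
  shows "(\<Sum>S | S \<subseteq> J \<and> card S = x. \<Prod>j\<in>S. q j) \<le> (\<Sum>j\<in>J. q j) ^ x / fact x"
  using assms
proof (induction J arbitrary: x rule: finite_induct)
  case empty
  then show ?case by (cases x) (auto simp: card_eq_0_iff cong: conj_cong)
next
  case (insert j J)
  let ?e = "\<lambda>J x. \<Sum>S | S \<subseteq> J \<and> card S = x. \<Prod>j\<in>S. q j"
  let ?\<sigma> = "\<Sum>j\<in>J. q j"
  show ?case
  proof (cases x)
    case 0
    have "{S. S \<subseteq> insert j J \<and> card S = 0} = {{}}"
      using insert by (auto simp: card_eq_0_iff dest: finite_subset)
    then show ?thesis using 0 by simp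
  next
    case (Suc k)
    have split: "{S. S \<subseteq> insert j J \<and> card S = Suc k}
      = {S. S \<subseteq> J \<and> card S = Suc k} \<union> insert j ` {S. S \<subseteq> J \<and> card S = k}" (is "?L = ?A \<union> ?B")
    proof (intro equalityI subsetI)
      fix S assume S: "S \<in> ?L"
      show "S \<in> ?A \<union> ?B"
      proof (cases "j \<in> S")
        case True
        then have "S = insert j (S - {j})" "S - {j} \<subseteq> J" "card (S - {j}) = k"
          using S insert by (auto simp: card_Diff_singleton)
        then show ?thesis by blast
      qed (use S in auto)
    next
      fix S assume "S \<in> ?A \<union> ?B"
      then show "S \<in> ?L"
        using insert by (auto simp: card_insert_if finite_subset)
    qed
    have "?e (insert j J) (Suc k) = ?e J (Suc k) + (\<Sum>S\<in>?B. \<Prod>j\<in>S. q j)"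
      unfolding split using insert by (intro sum.union_disjoint) auto
    also have "(\<Sum>S\<in>?B. \<Prod>j\<in>S. q j) = (\<Sum>S | S \<subseteq> J \<and> card S = k. q j * (\<Prod>j\<in>S. q j))"
    proof (subst sum.reindex)
      show "inj_on (insert j) {S. S \<subseteq> J \<and> card S = k}"
        using insert.hyps(2) by (intro inj_onI) (metis (mono_tags, lifting) insert_ident mem_Collect_eq subsetD)
      show "sum (prod q \<circ> insert j) {S. S \<subseteq> J \<and> card S = k}
        = (\<Sum>S | S \<subseteq> J \<and> card S = k. q j * (\<Prod>j\<in>S. q j))"
        using insert.hyps by (intro sum.cong refl) (auto simp: finite_subset prod.insert_if)
    qed
    also have "\<dots> = q j * ?e J k" by (simp add: sum_distrib_left)
    also have "?e J (Suc k) + q j * ?e J k \<le> ?\<sigma> ^ Suc k / fact (Suc k) + q j * (?\<sigma> ^ k / fact k)"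
      using insert.prems by (intro add_mono mult_left_mono insert.IH) auto
    also have "\<dots> = (?\<sigma> ^ Suc k + Suc k * q j * ?\<sigma> ^ k) / fact (Suc k)"
      by (simp add: field_simps del: of_nat_Suc)
    also have "?\<sigma> ^ Suc k + Suc k * q j * ?\<sigma> ^ k \<le> (q j + ?\<sigma>) ^ Suc k"
    proof -
      have "0 \<le> ?\<sigma>" "0 \<le> q j" using insert by (auto intro: sum_nonneg)
      then show ?thesis
      proof (induction k)
        case (Suc k)
        let ?s = ?\<sigma> and ?q = "q j"
        have "?s ^ Suc (Suc k) + Suc (Suc k) * ?q * ?s ^ Suc k
          \<le> (?q + ?s) * (?s ^ Suc k + Suc k * ?q * ?s ^ k)"
          using Suc.prems by (simp add: algebra_simps)
        also have "\<dots> \<le> (?q + ?s) * (?q + ?s) ^ Suc k"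
          using Suc by (intro mult_left_mono) auto
        finally show ?case by simp
      qed simp
    qed
    finally show ?thesis
      using Suc insert by (simp add: divide_right_mono)
  qed
qed

text \<open>
  A vector of 0/1 values indexed by \<open>J\<close> is identified with the set \<open>S\<close> of the indices where it is 1.
  Working with weighted sums over subsets turns all probabilities below into finite sums.
\<close>

definition bernoulli_weight :: "('a \<Rightarrow> real) \<Rightarrow> 'a set \<Rightarrow> 'a set \<Rightarrow> real" where
  "bernoulli_weight p J S = (\<Prod>j\<in>S. p j) * (\<Prod>j\<in>J - S. 1 - p j)"

lemma bernoulli_weight_nonneg:
  assumes "\<And>j. j \<in> J \<Longrightarrow> 0 \<le> p j \<and> p j \<le> 1" and "S \<subseteq> J"
  shows "0 \<le> bernoulli_weight p J S"
  unfolding bernoulli_weight_def using assms by (intro mult_nonneg_nonneg prod_nonneg) auto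

lemma sum_bernoulli_weight_exp:
  assumes "finite J"
  shows "(\<Sum>S\<in>Pow J. bernoulli_weight p J S * exp (\<Sum>j\<in>S. t j))
    = (\<Prod>j\<in>J. p j * exp (t j) + (1 - p j))"
proof -
  have "(\<Sum>S\<in>Pow J. bernoulli_weight p J S * exp (\<Sum>j\<in>S. t j))
    = (\<Sum>S\<in>Pow J. (\<Prod>j\<in>S. p j * exp (t j)) * (\<Prod>j\<in>J - S. 1 - p j))"
    using assms
    by (intro sum.cong refl) (auto simp: bernoulli_weight_def prod.distrib exp_sum finite_subset)
  then show ?thesis using assms by (simp add: prod_add)
qed

lemma sum_bernoulli_weight_exp_le:
  assumes "finite J" and "\<And>j. j \<in> J \<Longrightarrow> 0 \<le> p j \<and> p j \<le> 1"
  shows "(\<Sum>S\<in>Pow J. bernoulli_weight p J S * exp (\<Sum>j\<in>S. t j))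
    \<le> exp (\<Sum>j\<in>J. p j * (exp (t j) - 1))"
  unfolding sum_bernoulli_weight_exp[OF assms(1)] exp_sum[OF assms(1)]
proof (intro prod_mono conjI)
  fix j assume "j \<in> J"
  then show "0 \<le> p j * exp (t j) + (1 - p j)" using assms(2) by (auto intro!: add_nonneg_nonneg)
  show "p j * exp (t j) + (1 - p j) \<le> exp (p j * (exp (t j) - 1))"
    using exp_ge_add_one_self[of "p j * (exp (t j) - 1)"] by (simp add: algebra_simps)
qed

lemma bernoulli_chernoff:
  assumes "finite J" and "\<And>j. j \<in> J \<Longrightarrow> 0 \<le> p j \<and> p j \<le> 1" and "0 \<le> s"
  shows "(\<Sum>S | S \<subseteq> J \<and> 0 \<le> (\<Sum>j\<in>S. t j) + d. bernoulli_weight p J S)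
    \<le> exp (s * d + (\<Sum>j\<in>J. p j * (exp (s * t j) - 1)))"
proof -
  let ?w = "bernoulli_weight p J"
  have "(\<Sum>S | S \<subseteq> J \<and> 0 \<le> (\<Sum>j\<in>S. t j) + d. ?w S)
    \<le> (\<Sum>S | S \<subseteq> J \<and> 0 \<le> (\<Sum>j\<in>S. t j) + d. ?w S * exp (s * ((\<Sum>j\<in>S. t j) + d)))"
  proof (intro sum_mono)
    fix S assume "S \<in> {S. S \<subseteq> J \<and> 0 \<le> (\<Sum>j\<in>S. t j) + d}"
    then have "1 \<le> exp (s * ((\<Sum>j\<in>S. t j) + d))" "0 \<le> ?w S"
      using assms(3) by (auto intro: bernoulli_weight_nonneg[OF assms(2)])
    then show "?w S \<le> ?w S * exp (s * ((\<Sum>j\<in>S. t j) + d))"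
      using mult_left_mono by fastforce
  qed
  also have "\<dots> \<le> (\<Sum>S\<in>Pow J. ?w S * exp (s * ((\<Sum>j\<in>S. t j) + d)))"
    using assms by (intro sum_mono2) (auto intro!: mult_nonneg_nonneg bernoulli_weight_nonneg)
  also have "\<dots> = exp (s * d) * (\<Sum>S\<in>Pow J. ?w S * exp (\<Sum>j\<in>S. s * t j))"
    by (simp add: sum_distrib_left distrib_left exp_add mult_ac)
  also have "\<dots> \<le> exp (s * d) * exp (\<Sum>j\<in>J. p j * (exp (s * t j) - 1))"
    using assms by (intro mult_left_mono sum_bernoulli_weight_exp_le) auto
  finally show ?thesis by (simp add: exp_add)
qed

text \<open>
  Domination by an unnormalised Poisson law.  Since \<open>1 - p \<le> exp (- p)\<close>, a set of \<open>x\<close> successes has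
  weight at most \<open>exp (- \<Sum> p)\<close> times the product of \<open>p j * exp (p j)\<close> over the successes: the factor
  \<open>exp (p j)\<close> compensates for a success not contributing its failure factor.  The price is the
  larger mean \<open>\<Sum> p j * exp (p j)\<close>, which exceeds \<open>\<Sum> p j\<close> only to second order in \<open>p\<close>.
\<close>

lemma bernoulli_count_le_poisson:
  assumes "finite J" and p: "\<And>j. j \<in> J \<Longrightarrow> 0 \<le> p j \<and> p j \<le> 1"
  shows "(\<Sum>S | S \<subseteq> J \<and> card S = x. bernoulli_weight p J S)
    \<le> exp (- (\<Sum>j\<in>J. p j)) * (\<Sum>j\<in>J. p j * exp (p j)) ^ x / fact x"
proof -
  have "(\<Sum>S | S \<subseteq> J \<and> card S = x. bernoulli_weight p J S)
    \<le> (\<Sum>S | S \<subseteq> J \<and> card S = x. exp (- (\<Sum>j\<in>J. p j)) * (\<Prod>j\<in>S. p j * exp (p j)))"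
  proof (intro sum_mono)
    fix S assume "S \<in> {S. S \<subseteq> J \<and> card S = x}"
    then have S: "S \<subseteq> J" "finite S" using assms(1) finite_subset by auto
    have "(\<Prod>j\<in>J - S. 1 - p j) \<le> (\<Prod>j\<in>J - S. exp (- p j))"
      using p exp_ge_add_one_self[of "- p _"] by (intro prod_mono) auto
    also have "\<dots> = exp (- (\<Sum>j\<in>J - S. p j))" using assms(1) by (simp add: exp_sum flip: sum_negf)
    also have "\<dots> = exp (- (\<Sum>j\<in>J. p j)) * (\<Prod>j\<in>S. exp (p j))"
      using sum.subset_diff[OF S(1) assms(1), of p] S
      by (simp flip: exp_sum exp_add)
    finally have "bernoulli_weight p J S
      \<le> (\<Prod>j\<in>S. p j) * (exp (- (\<Sum>j\<in>J. p j)) * (\<Prod>j\<in>S. exp (p j)))"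
      unfolding bernoulli_weight_def using p S by (intro mult_left_mono prod_nonneg) auto
    then show "bernoulli_weight p J S
      \<le> exp (- (\<Sum>j\<in>J. p j)) * (\<Prod>j\<in>S. p j * exp (p j))"
      by (simp add: prod.distrib mult_ac)
  qed
  also have "\<dots> \<le> exp (- (\<Sum>j\<in>J. p j)) * ((\<Sum>j\<in>J. p j * exp (p j)) ^ x / fact x)"
    unfolding sum_distrib_left[symmetric] using assms
    by (intro mult_left_mono sum_prod_subsets_card_le) auto
  finally show ?thesis by simp
qed

text \<open>
  The Bahadur-Rao improvement of the Chernoff bound.  After an exponential tilt the count is
  compared with a Poisson variable of mean \<open>\<mu>\<close>, all of whose masses are at most \<open>1 / sqrt \<mu>\<close>; the
  tilting factor \<open>exp (- s * \<theta> * x)\<close> decays geometrically away from the boundary of the event, so only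
  about \<open>1 / (s * \<bar>\<theta>\<bar>)\<close> masses contribute.
\<close>

lemma bernoulli_count_tail_le:
  fixes p :: "'a \<Rightarrow> real" and s \<theta> w :: real
  assumes "finite J" and p: "\<And>j. j \<in> J \<Longrightarrow> 0 \<le> p j \<and> p j \<le> 1"
    and "0 < s" and "\<theta> \<noteq> 0"
  defines "\<mu> \<equiv> (\<Sum>j\<in>J. p j * exp (p j)) * exp (s * \<theta>)"
  assumes "0 < \<mu>"
  shows "(\<Sum>S | S \<subseteq> J \<and> 0 \<le> \<theta> * card S + w. bernoulli_weight p J S)
    \<le> exp (s * w) * exp (\<mu> - (\<Sum>j\<in>J. p j)) / (sqrt \<mu> * (1 - exp (- (s * \<bar>\<theta>\<bar>))))"
proof -
  define l where "l = (\<Sum>j\<in>J. p j)"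
  have "(\<Sum>S | S \<subseteq> J \<and> 0 \<le> \<theta> * card S + w. bernoulli_weight p J S)
    = (\<Sum>x | x \<in> {..card J} \<and> 0 \<le> \<theta> * real x + w.
        \<Sum>S | S \<in> {S. S \<subseteq> J \<and> 0 \<le> \<theta> * card S + w} \<and> card S = x. bernoulli_weight p J S)"
    using assms(1) by (intro sum.group[symmetric]) (auto intro: card_mono)
  also have "\<dots> = (\<Sum>x | x \<in> {..card J} \<and> 0 \<le> \<theta> * real x + w.
        \<Sum>S | S \<subseteq> J \<and> card S = x. bernoulli_weight p J S)"
    by (intro sum.cong refl) auto
  also have "\<dots> \<le> (\<Sum>x | x \<in> {..card J} \<and> 0 \<le> \<theta> * real x + w.
        exp (\<mu> - l) / sqrt \<mu> * exp (- (s * \<theta> * x)))"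
  proof (intro sum_mono)
    fix x :: nat
    have "(\<Sum>S | S \<subseteq> J \<and> card S = x. bernoulli_weight p J S)
      \<le> exp (- l) * (\<Sum>j\<in>J. p j * exp (p j)) ^ x / fact x"
      unfolding l_def using assms(1) p by (rule bernoulli_count_le_poisson)
    \<comment> \<open>Passing from the mean before tilting to \<open>\<mu>\<close> costs exactly the factor \<open>exp (- s \<theta> x)\<close>.\<close>
    also have "\<dots> = exp (- l) * exp (- (s * \<theta> * x)) * (\<mu> ^ x / fact x)"
      by (simp add: \<mu>_def power_mult_distrib exp_minus field_simps flip: exp_of_nat_mult)
    also have "\<dots> \<le> exp (- l) * exp (- (s * \<theta> * x)) * (exp \<mu> / sqrt \<mu>)"
      using \<open>0 < \<mu>\<close> by (intro mult_left_mono poisson_mass_le) auto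
    also have "\<dots> = exp (\<mu> - l) / sqrt \<mu> * exp (- (s * \<theta> * x))"
      by (simp add: exp_diff exp_minus field_simps)
    finally show "(\<Sum>S | S \<subseteq> J \<and> card S = x. bernoulli_weight p J S)
      \<le> exp (\<mu> - l) / sqrt \<mu> * exp (- (s * \<theta> * x))" .
  qed
  also have "\<dots> = exp (\<mu> - l) / sqrt \<mu> *
      (\<Sum>x | x \<in> {..card J} \<and> 0 \<le> s * \<theta> * real x + s * w. exp (- (s * \<theta> * x)))"
  proof -
    have "0 \<le> s * \<theta> * real x + s * w \<longleftrightarrow> 0 \<le> \<theta> * real x + w" for x
      using zero_le_mult_iff[of s "\<theta> * real x + w"] \<open>0 < s\<close> by (simp add: distrib_left mult.assoc)
    then show ?thesis by (simp add: sum_distrib_left)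
  qed
  also have "\<dots> \<le> exp (\<mu> - l) / sqrt \<mu> * (exp (s * w) / (1 - exp (- \<bar>s * \<theta>\<bar>)))"
    using assms by (intro mult_left_mono sum_exp_halfline_le) auto
  finally show ?thesis
    using \<open>0 < s\<close> by (simp add: l_def abs_mult mult_ac)
qed

lemma sum_bernoulli_weight_split:
  assumes "finite J" and "B \<subseteq> J"
  shows "(\<Sum>S | S \<subseteq> J \<and> Q S. bernoulli_weight p J S)
    = (\<Sum>U\<in>Pow (J - B). bernoulli_weight p (J - B) U *
        (\<Sum>V | V \<subseteq> B \<and> Q (U \<union> V). bernoulli_weight p B V))"
proof -
  have fin: "finite B" "finite (J - B)" using assms finite_subset by auto
  have "(\<Sum>U\<in>Pow (J - B). bernoulli_weight p (J - B) U *
        (\<Sum>V | V \<subseteq> B \<and> Q (U \<union> V). bernoulli_weight p B V))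
    = (\<Sum>(U, V)\<in>(SIGMA U:Pow (J - B). {V. V \<subseteq> B \<and> Q (U \<union> V)}).
        bernoulli_weight p (J - B) U * bernoulli_weight p B V)"
    using fin by (subst sum.Sigma[symmetric]) (auto simp: sum_distrib_left)
  also have "\<dots> = (\<Sum>S | S \<subseteq> J \<and> Q S. bernoulli_weight p J S)"
  proof (rule sum.reindex_bij_witness[where i = "\<lambda>S. (S - B, S \<inter> B)" and j = "\<lambda>(U, V). U \<union> V"])
    fix UV assume UV: "UV \<in> (SIGMA U:Pow (J - B). {V. V \<subseteq> B \<and> Q (U \<union> V)})"
    obtain U V where eq: "UV = (U, V)" by (cases UV)
    have sub: "U \<subseteq> J - B" "V \<subseteq> B" using UV eq by auto
    have "J - (U \<union> V) = (J - B - U) \<union> (B - V)" using sub assms by auto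
    moreover have "(\<Prod>j\<in>U \<union> V. p j) = (\<Prod>j\<in>U. p j) * (\<Prod>j\<in>V. p j)"
      using sub fin by (intro prod.union_disjoint) (auto dest: finite_subset)
    moreover have "(\<Prod>j\<in>(J - B - U) \<union> (B - V). 1 - p j)
      = (\<Prod>j\<in>J - B - U. 1 - p j) * (\<Prod>j\<in>B - V. 1 - p j)"
      using sub fin by (intro prod.union_disjoint) auto
    ultimately show "bernoulli_weight p J (case UV of (U, V) \<Rightarrow> U \<union> V)
      = (case UV of (U, V) \<Rightarrow> bernoulli_weight p (J - B) U * bernoulli_weight p B V)"
      by (simp add: bernoulli_weight_def eq mult_ac)
  qed (use assms in \<open>auto simp: Un_Diff_Int Un_commute Int_Un_distrib2\<close>)
  finally show ?thesis by simp
qed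

text \<open>
  It is enough that the summands in one block \<open>B\<close> share a common nonzero value \<open>\<theta>\<close>: the tail bound for the
  count in \<open>B\<close> is uniform in the shift caused by the other summands, so conditionally on them it
  applies with that shift, and they are then treated by the plain Chernoff bound.
\<close>

lemma bernoulli_sharp_chernoff:
  fixes p t :: "'a \<Rightarrow> real" and s \<theta> d :: real
  assumes "finite J" and p: "\<And>j. j \<in> J \<Longrightarrow> 0 \<le> p j \<and> p j \<le> 1"
    and "B \<subseteq> J" and t: "\<And>j. j \<in> B \<Longrightarrow> t j = \<theta>" and "0 < s" and "\<theta> \<noteq> 0"
  defines "\<mu> \<equiv> (\<Sum>j\<in>B. p j * exp (p j)) * exp (s * \<theta>)"
  assumes "0 < \<mu>"
  shows "(\<Sum>S | S \<subseteq> J \<and> 0 \<le> (\<Sum>j\<in>S. t j) + d. bernoulli_weight p J S)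
    \<le> exp (s * d + (\<Sum>j\<in>J. p j * (exp (s * t j) - 1)))
      * exp (\<mu> - (\<Sum>j\<in>B. p j) * exp (s * \<theta>)) / (sqrt \<mu> * (1 - exp (- (s * \<bar>\<theta>\<bar>))))"
proof -
  let ?l = "\<Sum>j\<in>B. p j"
  have fin: "finite B" "finite (J - B)" using assms finite_subset by auto
  define C where "C = exp (\<mu> - ?l) / (sqrt \<mu> * (1 - exp (- (s * \<bar>\<theta>\<bar>))))"
  have C: "0 \<le> C" unfolding C_def using assms by (intro divide_nonneg_nonneg mult_nonneg_nonneg) auto
  have "(\<Sum>S | S \<subseteq> J \<and> 0 \<le> (\<Sum>j\<in>S. t j) + d. bernoulli_weight p J S)
    = (\<Sum>U\<in>Pow (J - B). bernoulli_weight p (J - B) U *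
        (\<Sum>V | V \<subseteq> B \<and> 0 \<le> (\<Sum>j\<in>U \<union> V. t j) + d. bernoulli_weight p B V))"
    using assms by (intro sum_bernoulli_weight_split)
  also have "\<dots> \<le> (\<Sum>U\<in>Pow (J - B). bernoulli_weight p (J - B) U *
        (exp (s * ((\<Sum>j\<in>U. t j) + d)) * C))"
  proof (intro sum_mono mult_left_mono)
    fix U assume U: "U \<in> Pow (J - B)"
    have "(\<Sum>j\<in>U \<union> V. t j) = \<theta> * card V + (\<Sum>j\<in>U. t j)" if "V \<subseteq> B" for V
    proof -
      have "(\<Sum>j\<in>U \<union> V. t j) = (\<Sum>j\<in>U. t j) + (\<Sum>j\<in>V. t j)"
        using U that fin by (intro sum.union_disjoint) (auto dest: finite_subset)
      moreover have "(\<Sum>j\<in>V. t j) = (\<Sum>j\<in>V. \<theta>)" using t that by (intro sum.cong) auto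
      ultimately show ?thesis by simp
    qed
    then have "{V. V \<subseteq> B \<and> 0 \<le> (\<Sum>j\<in>U \<union> V. t j) + d}
      = {V. V \<subseteq> B \<and> 0 \<le> \<theta> * card V + ((\<Sum>j\<in>U. t j) + d)}" by auto
    moreover have "(\<Sum>V | V \<subseteq> B \<and> 0 \<le> \<theta> * card V + ((\<Sum>j\<in>U. t j) + d). bernoulli_weight p B V)
      \<le> exp (s * ((\<Sum>j\<in>U. t j) + d)) * exp (\<mu> - ?l) / (sqrt \<mu> * (1 - exp (- (s * \<bar>\<theta>\<bar>))))"
      unfolding \<mu>_def using assms fin by (intro bernoulli_count_tail_le) auto
    ultimately show "(\<Sum>V | V \<subseteq> B \<and> 0 \<le> (\<Sum>j\<in>U \<union> V. t j) + d. bernoulli_weight p B V)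
      \<le> exp (s * ((\<Sum>j\<in>U. t j) + d)) * C" by (simp add: C_def)
    show "0 \<le> bernoulli_weight p (J - B) U"
      using U p by (intro bernoulli_weight_nonneg) auto
  qed
  also have "\<dots> = exp (s * d) * C * (\<Sum>U\<in>Pow (J - B). bernoulli_weight p (J - B) U * exp (\<Sum>j\<in>U. s * t j))"
    by (simp add: sum_distrib_left distrib_left exp_add mult_ac)
  also have "\<dots> \<le> exp (s * d) * C * exp (\<Sum>j\<in>J - B. p j * (exp (s * t j) - 1))"
    using p C fin by (intro mult_left_mono sum_bernoulli_weight_exp_le) auto
  also have "(\<Sum>j\<in>J - B. p j * (exp (s * t j) - 1))
    = (\<Sum>j\<in>J. p j * (exp (s * t j) - 1)) - ?l * (exp (s * \<theta>) - 1)"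
    using t sum_diff[OF assms(1,3), of "\<lambda>j. p j * (exp (s * t j) - 1)"]
    by (simp add: sum_distrib_right cong: sum.cong)
  also have "exp (s * d) * C * exp ((\<Sum>j\<in>J. p j * (exp (s * t j) - 1)) - ?l * (exp (s * \<theta>) - 1))
    = exp (s * d + (\<mu> - ?l) + ((\<Sum>j\<in>J. p j * (exp (s * t j) - 1)) - ?l * (exp (s * \<theta>) - 1)))
      / (sqrt \<mu> * (1 - exp (- (s * \<bar>\<theta>\<bar>))))"
    unfolding C_def exp_add by simp
  also have "s * d + (\<mu> - ?l) + ((\<Sum>j\<in>J. p j * (exp (s * t j) - 1)) - ?l * (exp (s * \<theta>) - 1))
    = (s * d + (\<Sum>j\<in>J. p j * (exp (s * t j) - 1))) + (\<mu> - ?l * exp (s * \<theta>))"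
    by (simp add: right_diff_distrib)
  finally show ?thesis by (simp only: exp_add)
qed

section \<open>Rows of the stochastic block model\<close>

lemma sbmD:
  assumes "sbm M A y z P"
  shows "prob_space M"
    and "prob_space.indep_vars M (\<lambda>_. count_space UNIV) (\<lambda>(i, j). A i j) UNIV"
    and "A i j \<in> measurable M (count_space UNIV)"
    and "distr M (count_space UNIV) (A i j) = measure_pmf (bernoulli_pmf (P $ y i $ z j))"
    and "0 \<le> P $ k $ l" and "P $ k $ l \<le> 1"
proof -
  show "prob_space M" using assms by (simp add: sbm_def)
  then interpret prob_space M .
  show indep: "indep_vars (\<lambda>_. count_space UNIV) (\<lambda>(i, j). A i j) UNIV"
    using assms by (simp add: sbm_def)
  then show "A i j \<in> measurable M (count_space UNIV)"
    by (auto simp: indep_vars_def dest!: bspec[of UNIV _ "(i, j)"])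
qed (use assms in \<open>auto simp: sbm_def\<close>)

text \<open>
  Every event about row \<open>i\<close> is a union of the finitely many events that fix the row completely, so it is
  measurable and its probability is a weighted sum over subsets.
\<close>

lemma sbm_row_prob:
  fixes A :: "'n::finite \<Rightarrow> 'm::finite \<Rightarrow> 'w \<Rightarrow> bool"
  assumes "sbm M A y z P"
  shows "\<P>(w in M. Q {j. A i j w})
    = (\<Sum>S | S \<subseteq> UNIV \<and> Q S. bernoulli_weight (\<lambda>j. P $ y i $ z j) UNIV S)"
proof -
  interpret prob_space M by (rule sbmD(1)[OF assms])
  note [measurable] = sbmD(3)[OF assms]
  note indep = sbmD(2)[OF assms] and distr = sbmD(4)[OF assms] and P = sbmD(5,6)[OF assms]
  have entry: "prob (A i j -` {b} \<inter> space M) = (if b then P $ y i $ z j else 1 - P $ y i $ z j)" for j b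
  proof -
    have "prob (A i j -` {b} \<inter> space M) = measure (distr M (count_space UNIV) (A i j)) {b}"
      by (subst measure_distr) auto
    then show ?thesis using P by (cases b) (simp_all add: distr measure_pmf_single)
  qed
  define E where "E S = {w \<in> space M. {j. A i j w} = S}" for S
  have E_inter: "E S = (\<Inter>ij\<in>{i} \<times> UNIV. (case ij of (i, j) \<Rightarrow> A i j) -` {snd ij \<in> S} \<inter> space M)" for S
  proof (rule set_eqI)
    fix w
    have "w \<in> E S \<longleftrightarrow> w \<in> space M \<and> (\<forall>j. A i j w = (j \<in> S))"
      by (auto simp: E_def)
    then show "w \<in> E S \<longleftrightarrow>
      w \<in> (\<Inter>ij\<in>{i} \<times> UNIV. (case ij of (i, j) \<Rightarrow> A i j) -` {snd ij \<in> S} \<inter> space M)"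
      by (simp, blast)
  qed
  have E_sets: "E S \<in> sets M" for S
    unfolding E_inter
    by (rule sets.finite_INT) (auto intro: measurable_sets[OF sbmD(3)[OF assms]])
  have prob_E: "prob (E S) = bernoulli_weight (\<lambda>j. P $ y i $ z j) UNIV S" for S
  proof -
    have "prob (E S) = (\<Prod>ij\<in>{i} \<times> UNIV. prob ((case ij of (i, j) \<Rightarrow> A i j) -` {snd ij \<in> S} \<inter> space M))"
      unfolding E_inter using indep by (rule indep_varsD) auto
    also have "\<dots> = (\<Prod>j\<in>UNIV. prob (A i j -` {j \<in> S} \<inter> space M))"
      by (rule prod.reindex_bij_witness[where i = "\<lambda>j. (i, j)" and j = snd]) auto
    also have "\<dots> = (\<Prod>j\<in>UNIV. if j \<in> S then P $ y i $ z j else 1 - P $ y i $ z j)"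
      by (simp add: entry)
    also have "\<dots> = bernoulli_weight (\<lambda>j. P $ y i $ z j) UNIV S"
      by (simp add: bernoulli_weight_def prod.If_cases Compl_eq_Diff_UNIV)
    finally show ?thesis .
  qed
  have "{w \<in> space M. Q {j. A i j w}} = (\<Union>S\<in>{S. S \<subseteq> UNIV \<and> Q S}. E S)"
    by (auto simp: E_def)
  also have "prob \<dots> = (\<Sum>S | S \<subseteq> UNIV \<and> Q S. prob (E S))"
  proof (rule finite_measure_finite_Union)
    show "E ` {S. S \<subseteq> UNIV \<and> Q S} \<subseteq> sets M"
      using E_sets by auto
  qed (auto simp: disjoint_family_on_def E_def)
  finally show ?thesis by (simp add: prob_E)
qed

lemma sbm_row_mean:
  fixes A :: "'n::finite \<Rightarrow> 'm::finite \<Rightarrow> 'w \<Rightarrow> bool"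
  assumes "sbm M A y z P"
  shows "row_mean_mat M A y zt $ y i $ l = (\<Sum>j | zt j = l. P $ y i $ z j)"
proof -
  interpret prob_space M by (rule sbmD(1)[OF assms])
  note [measurable] = sbmD(3)[OF assms]
  note indep = sbmD(2)[OF assms] and distr = sbmD(4)[OF assms] and P = sbmD(5,6)[OF assms]
  have mean: "integral\<^sup>L M (\<lambda>w. of_bool (A i j w)) = P $ y i $ z j" for i j
  proof -
    have "integral\<^sup>L M (\<lambda>w. of_bool (A i j w))
      = integral\<^sup>L (distr M (count_space UNIV) (A i j)) (of_bool :: bool \<Rightarrow> real)"
      by (subst integral_distr) auto
    then show ?thesis using P by (simp add: distr)
  qed
  have "(\<Sum>i'\<in>UNIV. \<Sum>j\<in>UNIV. integral\<^sup>L M (\<lambda>w. of_bool (A i' j w)) * of_bool (y i' = y i \<and> zt j = l))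
    = (\<Sum>i' | y i' = y i. \<Sum>j | zt j = l. P $ y i $ z j)"
  proof -
    have "(\<Sum>j\<in>UNIV. P $ y i' $ z j * of_bool (y i' = y i \<and> zt j = l))
      = of_bool (y i' = y i) * (\<Sum>j | zt j = l. P $ y i $ z j)" for i'
      by (auto simp: sum_distrib_left of_bool_def intro!: sum.mono_neutral_cong_right split: if_splits)
    then show ?thesis
      unfolding mean by (simp add: sum_distrib_right[symmetric])
  qed
  also have "\<dots> = cluster_size y (y i) * (\<Sum>j | zt j = l. P $ y i $ z j)"
    by (simp add: cluster_size_def)
  finally have total: "(\<Sum>i'\<in>UNIV. \<Sum>j\<in>UNIV.
      integral\<^sup>L M (\<lambda>w. of_bool (A i' j w)) * of_bool (y i' = y i \<and> zt j = l))
    = cluster_size y (y i) * (\<Sum>j | zt j = l. P $ y i $ z j)" .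
  have "cluster_size y (y i) \<noteq> 0" by (auto simp: cluster_size_def)
  then show ?thesis unfolding row_mean_mat_def vec_lambda_beta total by simp
qed

lemma block_sums_inner:
  "(\<Sum>l\<in>UNIV. block_sums A zt i w $ l * \<theta> l) = (\<Sum>j | A i j w. \<theta> (zt j))"
proof -
  have "(\<Sum>l\<in>UNIV. block_sums A zt i w $ l * \<theta> l)
    = (\<Sum>j\<in>UNIV. \<Sum>l\<in>UNIV. of_bool (A i j w) * of_bool (zt j = l) * \<theta> l)"
    unfolding block_sums_def by (subst sum.swap) (simp add: sum_distrib_right del: sum_of_bool_mult_eq sum_mult_of_bool_eq)
  also have "\<dots> = (\<Sum>j\<in>UNIV. of_bool (A i j w) * \<theta> (zt j))"
    proof (rule sum.cong[OF refl])
    fix j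
    have "(\<Sum>l\<in>UNIV. of_bool (A i j w) * of_bool (zt j = l) * \<theta> l)
      = (\<Sum>l\<in>UNIV. if l = zt j then of_bool (A i j w) * \<theta> l else 0)"
      by (intro sum.cong) auto
    then show "(\<Sum>l\<in>UNIV. of_bool (A i j w) * of_bool (zt j = l) * \<theta> l)
      = of_bool (A i j w) * \<theta> (zt j)" by simp
  qed
  also have "\<dots> = (\<Sum>j | A i j w. \<theta> (zt j))"
    by (rule sum.mono_neutral_cong_right) auto
  finally show ?thesis .
qed

lemma abs_entry_le_max_norm: "\<bar>X $ a $ b\<bar> \<le> max_norm X"
  and min_entry_le: "min_entry X \<le> X $ a $ b" for X :: "real^'b::finite^'a::finite"
proof -
  have eq: "{f a b | a b. True} = range (\<lambda>(a, b). f a b)" for f :: "'a \<Rightarrow> 'b \<Rightarrow> real"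
    by auto
  show "\<bar>X $ a $ b\<bar> \<le> max_norm X" "min_entry X \<le> X $ a $ b"
    unfolding max_norm_def min_entry_def eq by (auto intro!: Max_ge Min_le)
qed

section \<open>The tilted exponent\<close>

lemma chernoff_term_mono:
  fixes a b s s\<^sub>0 :: real
  assumes "0 < a" "0 < b" "0 \<le> s" "s \<le> s\<^sub>0" "s\<^sub>0 \<le> 1 / (2 + \<bar>ln (b / a)\<bar>)"
  shows "(1 - s) * a + s * b - a powr (1 - s) * b powr s
    \<le> (1 - s\<^sub>0) * a + s\<^sub>0 * b - a powr (1 - s\<^sub>0) * b powr s\<^sub>0"
proof -
  define u where "u = ln (b / a)"
  have u: "a * exp u = b" using assms by (simp add: u_def)
  have geo: "a powr (1 - x) * b powr x = a * exp (x * u)" for x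
    using assms by (simp add: powr_def u_def ln_div flip: exp_add) (simp add: exp_add exp_diff algebra_simps)
  have "exp (s\<^sub>0 * u) * (1 + (s - s\<^sub>0) * u) \<le> exp (s\<^sub>0 * u) * exp ((s - s\<^sub>0) * u)"
    by (intro mult_left_mono) auto
  also have "\<dots> = exp (s * u)" by (simp add: algebra_simps flip: exp_add)
  finally have "exp (s\<^sub>0 * u) - exp (s * u) \<le> (s\<^sub>0 - s) * (u * exp (s\<^sub>0 * u))"
    by (simp add: algebra_simps)
  also have "\<dots> \<le> (s\<^sub>0 - s) * (exp u - 1)"
    using assms by (intro mult_left_mono mult_exp_le_exp_minus_one) (auto simp: u_def)
  finally have "a * (exp (s\<^sub>0 * u) - exp (s * u)) \<le> a * ((s\<^sub>0 - s) * (exp u - 1))"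
    using assms by (intro mult_left_mono) auto
  then show ?thesis unfolding geo unfolding u[symmetric] by (simp add: algebra_simps)
qed

text \<open>
  Here \<open>a\<close> and \<open>b\<close> are the two means of a column cluster, \<open>T\<close> is the tilt at the log-ratio inflated by the
  worst case over the ball, and \<open>G\<close> is the geometric mean of \<open>a\<close> and \<open>b\<close>.  The inflation multiplies
  \<open>G\<close> by a factor between 1 and \<open>(1 + \<rho>) / (1 - \<rho>) \<le> 2\<close>; with the additional \<open>1 + \<rho>\<close> the factor is at most
  \<open>1 + 5 * \<rho>\<close>.  The condition \<open>3 * \<rho> \<le> 1\<close> enters through these two numerical bounds.
\<close>

lemma tilted_mean_bounds:
  fixes a b \<rho> s m :: real
  assumes ab: "0 < a" "0 < b" "a \<le> m" "b \<le> m" and \<rho>: "0 \<le> \<rho>" "3 * \<rho> \<le> 1" and s: "0 < s" "s < 1"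
  defines "T \<equiv> exp (s * ln ((1 + \<rho>) / (1 - \<rho>) * (b / a)))"
  defines "G \<equiv> a powr (1 - s) * b powr s"
  shows "(1 + \<rho>) * (a * T) \<le> G + 5 * \<rho> * m" and "a * T \<le> 2 * m" and "min a b \<le> a * T"
proof -
  define c where "c = (1 + \<rho>) / (1 - \<rho>)"
  have c: "1 \<le> c" "c \<le> 2" using \<rho> by (auto simp: c_def field_simps)
  have "T = (c * (b / a)) powr s"
  proof -
    have "0 < c * (b / a)" using c ab by simp
    then show ?thesis unfolding T_def c_def[symmetric] powr_def using c ab by simp
  qed
  then have "T = c powr s * (b / a) powr s" using powr_mult[of c "b / a" s] c ab by simp
  moreover have "G = a * (b / a) powr s"
    using ab by (simp add: G_def powr_diff powr_divide)
  ultimately have aT: "a * T = c powr s * G" by simp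
  have cs: "1 \<le> c powr s" "c powr s \<le> c"
    using c s powr_mono[of s 1 c] powr_mono[of 0 s c] by auto
  have "min a b powr (1 - s) * min a b powr s \<le> G"
    unfolding G_def using ab s by (intro mult_mono powr_mono2) auto
  then have G1: "min a b \<le> G" using ab by (simp flip: powr_add)
  have "G \<le> m powr (1 - s) * m powr s"
    unfolding G_def using ab s by (intro mult_mono powr_mono2) auto
  then have G2: "G \<le> m" using ab by (simp flip: powr_add)
  have G0: "0 < G" using ab by (simp add: G_def)
  show "min a b \<le> a * T"
    unfolding aT using mult_right_mono[OF cs(1) less_imp_le[OF G0]] G1 by linarith
  have "c powr s * G \<le> 2 * m" using cs c G0 G2 by (intro mult_mono) auto
  then show "a * T \<le> 2 * m" using aT by simp
  have "(1 + \<rho>) * (1 + \<rho>) \<le> (1 + 5 * \<rho>) * (1 - \<rho>)"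
    using mult_left_mono[OF \<rho>(2,1)] by (simp add: algebra_simps)
  then have c5: "(1 + \<rho>) * c \<le> 1 + 5 * \<rho>" using \<rho> by (simp add: c_def pos_divide_le_eq)
  have "(1 + \<rho>) * (c powr s * G) \<le> (1 + \<rho>) * (c * G)"
    using cs G0 \<rho> by (intro mult_left_mono mult_right_mono) auto
  also have "\<dots> = ((1 + \<rho>) * c) * G" by simp
  also have "\<dots> \<le> (1 + 5 * \<rho>) * G" using c5 G0 by (intro mult_right_mono) auto
  also have "\<dots> \<le> G + 5 * \<rho> * m" using G2 \<rho> by (simp add: distrib_right mult_left_mono)
  finally show "(1 + \<rho>) * (a * T) \<le> G + 5 * \<rho> * m" using aT by simp
qed

lemma tilted_exponent_le:
  fixes a b a' \<rho> \<Delta> s m :: real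
  assumes ab: "0 < a" "0 < b" "a \<le> m" "b \<le> m" and \<rho>: "0 \<le> \<rho>" "3 * \<rho> \<le> 1" and s: "0 < s" "s < 1"
    and \<Delta>: "\<bar>a' - a\<bar> \<le> \<Delta>" "\<Delta> \<le> \<rho> * a"
  shows "s * (a - b + 2 * \<Delta>) + a' * (exp (s * ln ((1 + \<rho>) / (1 - \<rho>) * (b / a))) - 1)
    \<le> - ((1 - s) * a + s * b - a powr (1 - s) * b powr s) + (5 * \<rho> * m + 3 * \<Delta>)"
proof -
  define T where "T = exp (s * ln ((1 + \<rho>) / (1 - \<rho>) * (b / a)))"
  define G where "G = a powr (1 - s) * b powr s"
  have "a' \<le> (1 + \<rho>) * a" using \<Delta> by (simp add: distrib_right)
  then have "a' * T \<le> (1 + \<rho>) * a * T" by (intro mult_right_mono) (auto simp: T_def)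
  also have "\<dots> \<le> G + 5 * \<rho> * m"
    using tilted_mean_bounds(1)[OF ab \<rho> s] by (simp add: mult.assoc T_def G_def)
  finally have "a' * T \<le> G + 5 * \<rho> * m" .
  moreover have "s * \<Delta> \<le> \<Delta>" using s \<Delta> by (intro mult_left_le_one_le) auto
  moreover have "a - a' \<le> \<Delta>" using \<Delta> by simp
  ultimately have "s * (a - b + 2 * \<Delta>) + a' * (T - 1)
    \<le> - ((1 - s) * a + s * b - G) + (5 * \<rho> * m + 3 * \<Delta>)"
    by (simp add: algebra_simps)
  then show ?thesis by (simp add: T_def G_def)
qed

section \<open>Reduction to a single linear statistic\<close>

text \<open>
  A relative error of at most \<open>\<rho>\<close> in each entry changes each ratio by at most the factor
  \<open>(1 + \<rho>) / (1 - \<rho>)\<close>.  The resulting bound is the same for all matrices of the ball, which removes the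
  existential quantifier from the event.
\<close>

lemma Y_stat_le:
  fixes \<Lambda> X :: "real^'l::finite^'k::finite"
  assumes X: "X \<in> mat_ball \<Lambda> \<delta>" and b: "\<And>l. 0 \<le> b $ l" and pos: "\<And>k l. 0 < \<Lambda> $ k $ l"
    and \<rho>: "\<And>k l. \<delta> * max_norm \<Lambda> \<le> \<rho> * \<Lambda> $ k $ l" "0 \<le> \<rho>" "\<rho> < 1"
  shows "Y_stat k r b X \<le> (\<Sum>l\<in>UNIV. b $ l * ln ((1 + \<rho>) / (1 - \<rho>) * (\<Lambda> $ r $ l / \<Lambda> $ k $ l)))
    + (\<Sum>l\<in>UNIV. \<Lambda> $ k $ l - \<Lambda> $ r $ l + 2 * (\<delta> * max_norm \<Lambda>))"
  unfolding Y_stat_def sum.distrib[symmetric]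
proof (intro sum_mono)
  fix l
  have near: "\<bar>X $ k $ l - \<Lambda> $ k $ l\<bar> \<le> \<delta> * max_norm \<Lambda>" for k
    using X abs_entry_le_max_norm[of "X - \<Lambda>" k l] by (simp add: mat_ball_def)
  have up: "X $ r $ l \<le> (1 + \<rho>) * \<Lambda> $ r $ l" and lo: "(1 - \<rho>) * \<Lambda> $ k $ l \<le> X $ k $ l" for k r
    using near[of r] near[of k] \<rho>(1)[of r l] \<rho>(1)[of k l] by (simp_all add: algebra_simps)
  have low: "0 < (1 - \<rho>) * \<Lambda> $ k $ l" for k using \<rho> pos by simp
  then have Xpos: "0 < X $ k $ l" for k using lo[of k] by (meson less_le_trans)
  have "X $ r $ l / X $ k $ l \<le> ((1 + \<rho>) * \<Lambda> $ r $ l) / ((1 - \<rho>) * \<Lambda> $ k $ l)"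
    using up[of r] lo[of k] low[of k] Xpos[of r] by (intro frac_le) auto
  also have "\<dots> = (1 + \<rho>) / (1 - \<rho>) * (\<Lambda> $ r $ l / \<Lambda> $ k $ l)" by simp
  finally have "ln (X $ r $ l / X $ k $ l) \<le> ln ((1 + \<rho>) / (1 - \<rho>) * (\<Lambda> $ r $ l / \<Lambda> $ k $ l))"
    using Xpos by (subst ln_le_cancel_iff) (auto intro: less_le_trans[rotated] divide_pos_pos)
  then have "b $ l * ln (X $ r $ l / X $ k $ l)
    \<le> b $ l * ln ((1 + \<rho>) / (1 - \<rho>) * (\<Lambda> $ r $ l / \<Lambda> $ k $ l))"
    using b by (intro mult_left_mono) auto
  moreover have "X $ k $ l - X $ r $ l \<le> \<Lambda> $ k $ l - \<Lambda> $ r $ l + 2 * (\<delta> * max_norm \<Lambda>)"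
    using near[of k] near[of r] by linarith
  ultimately show "b $ l * ln (X $ r $ l / X $ k $ l) + X $ k $ l - X $ r $ l
    \<le> b $ l * ln ((1 + \<rho>) / (1 - \<rho>) * (\<Lambda> $ r $ l / \<Lambda> $ k $ l))
      + (\<Lambda> $ k $ l - \<Lambda> $ r $ l + 2 * (\<delta> * max_norm \<Lambda>))" by linarith
qed

lemma misclassification_prob_le:
  fixes A :: "'n::finite \<Rightarrow> 'm::finite \<Rightarrow> 'w \<Rightarrow> bool"
    and \<Lambda> P :: "real^'l::finite^'k::finite"
  assumes sbm: "sbm M A y z P" and pos: "\<And>k l. 0 < \<Lambda> $ k $ l"
    and \<rho>: "\<And>k l. \<delta> * max_norm \<Lambda> \<le> \<rho> * \<Lambda> $ k $ l" "0 \<le> \<rho>" "\<rho> < 1"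
  shows "\<P>(w in M. \<exists>X\<in>mat_ball \<Lambda> \<delta>. Y_stat k r (block_sums A zt i w) X \<ge> 0)
    \<le> (\<Sum>S | S \<subseteq> UNIV \<and>
          0 \<le> (\<Sum>j\<in>S. ln ((1 + \<rho>) / (1 - \<rho>) * (\<Lambda> $ r $ zt j / \<Lambda> $ k $ zt j)))
            + (\<Sum>l\<in>UNIV. \<Lambda> $ k $ l - \<Lambda> $ r $ l + 2 * (\<delta> * max_norm \<Lambda>)).
        bernoulli_weight (\<lambda>j. P $ y i $ z j) UNIV S)"
proof -
  define b :: "'m set \<Rightarrow> real^'l" where "b S = (\<chi> l. \<Sum>j\<in>UNIV. of_bool (j \<in> S) * of_bool (zt j = l))" for S
  have b: "block_sums A zt i w = b {j. A i j w}" for w by (simp add: block_sums_def b_def)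
  have inner: "(\<Sum>l\<in>UNIV. b S $ l * \<theta> l) = (\<Sum>j\<in>S. \<theta> (zt j))" for S \<theta>
    using block_sums_inner[of "\<lambda>_ j _. j \<in> S" zt undefined undefined \<theta>] by (simp add: b_def block_sums_def)
  have "\<P>(w in M. \<exists>X\<in>mat_ball \<Lambda> \<delta>. Y_stat k r (block_sums A zt i w) X \<ge> 0)
    = (\<Sum>S | S \<subseteq> UNIV \<and> (\<exists>X\<in>mat_ball \<Lambda> \<delta>. Y_stat k r (b S) X \<ge> 0).
        bernoulli_weight (\<lambda>j. P $ y i $ z j) UNIV S)"
    unfolding b by (rule sbm_row_prob[OF sbm])
  also have "\<dots> \<le> (\<Sum>S | S \<subseteq> UNIV \<and>
          0 \<le> (\<Sum>j\<in>S. ln ((1 + \<rho>) / (1 - \<rho>) * (\<Lambda> $ r $ zt j / \<Lambda> $ k $ zt j)))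
            + (\<Sum>l\<in>UNIV. \<Lambda> $ k $ l - \<Lambda> $ r $ l + 2 * (\<delta> * max_norm \<Lambda>)).
        bernoulli_weight (\<lambda>j. P $ y i $ z j) UNIV S)"
  proof (rule sum_mono2)
    show "{S. S \<subseteq> UNIV \<and> (\<exists>X\<in>mat_ball \<Lambda> \<delta>. Y_stat k r (b S) X \<ge> 0)} \<subseteq> {S. S \<subseteq> UNIV \<and>
          0 \<le> (\<Sum>j\<in>S. ln ((1 + \<rho>) / (1 - \<rho>) * (\<Lambda> $ r $ zt j / \<Lambda> $ k $ zt j)))
            + (\<Sum>l\<in>UNIV. \<Lambda> $ k $ l - \<Lambda> $ r $ l + 2 * (\<delta> * max_norm \<Lambda>))}"
    proof
      fix S assume "S \<in> {S. S \<subseteq> UNIV \<and> (\<exists>X\<in>mat_ball \<Lambda> \<delta>. Y_stat k r (b S) X \<ge> 0)}"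
      then obtain X where X: "X \<in> mat_ball \<Lambda> \<delta>" and Y: "0 \<le> Y_stat k r (b S) X" by blast
      have nonneg: "0 \<le> b S $ l" for l by (simp add: b_def sum_nonneg)
      show "S \<in> {S. S \<subseteq> UNIV \<and>
          0 \<le> (\<Sum>j\<in>S. ln ((1 + \<rho>) / (1 - \<rho>) * (\<Lambda> $ r $ zt j / \<Lambda> $ k $ zt j)))
            + (\<Sum>l\<in>UNIV. \<Lambda> $ k $ l - \<Lambda> $ r $ l + 2 * (\<delta> * max_norm \<Lambda>))}"
        using Y Y_stat_le[where \<rho> = \<rho> and k = k and r = r, OF X nonneg pos \<rho>]
        unfolding inner by simp
    qed
  qed (use sbmD(5,6)[OF sbm] in \<open>auto intro!: bernoulli_weight_nonneg\<close>)
  finally show ?thesis .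
qed

section \<open>The prefactor of the sharp bound\<close>

text \<open>
  Both factors of the prefactor are bounded with room to spare.  The mean \<open>\<mu>\<close> is at least
  \<open>2 / 3 * \<nu> \<ge> (3 / 11)\<^sup>2 * \<nu>\<close>.  With \<open>\<kappa> = 1 / \<epsilon>' + 1\<close>, the inequality \<open>ln (1 + \<epsilon>') \<ge> 1 / \<kappa>\<close> and the lower bound
  on \<open>s\<close> give \<open>1 / (s * \<bar>\<theta>\<bar>) \<le> (1 + \<omega>) * \<kappa>\<close>, so the geometric factor is at most \<open>3 * \<omega> * \<kappa>\<close>.
\<close>

lemma sharp_factor_le:
  fixes \<mu> \<nu> \<omega> \<epsilon>' s U \<theta> :: real
  assumes "0 < \<nu>" "2 / 3 * \<nu> \<le> \<mu>" and "0 < \<epsilon>'" "ln (1 + \<epsilon>') \<le> \<bar>\<theta>\<bar>"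
    and "0 \<le> U" "U \<le> \<omega> - 1" "1 / (2 + U) \<le> s"
  shows "1 / (sqrt \<mu> * (1 - exp (- (s * \<bar>\<theta>\<bar>)))) \<le> exp (ln (11 * \<omega> * (1 / \<epsilon>' + 1)) - 1 / 2 * ln \<nu>)"
proof -
  define \<kappa> where "\<kappa> = 1 / \<epsilon>' + 1"
  have \<kappa>: "1 \<le> \<kappa>" using assms by (simp add: \<kappa>_def)
  have \<omega>: "1 \<le> \<omega>" using assms by simp
  define x where "x = s * \<bar>\<theta>\<bar>"
  have "1 / \<kappa> \<le> \<bar>\<theta>\<bar>"
  proof -
    have "ln (inverse (1 + \<epsilon>')) \<le> inverse (1 + \<epsilon>') - 1"
      using assms by (intro ln_le_minus_one) auto
    moreover have "1 / \<kappa> = 1 - inverse (1 + \<epsilon>')" using assms by (simp add: \<kappa>_def field_simps)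
    moreover have "ln (inverse (1 + \<epsilon>')) = - ln (1 + \<epsilon>')" using assms by (subst ln_inverse) auto
    ultimately show ?thesis using assms(4) by linarith
  qed
  then have "1 / (2 + U) * (1 / \<kappa>) \<le> x"
    unfolding x_def using assms \<kappa> by (intro mult_mono) (auto intro: order_trans[rotated])
  moreover have "1 / ((1 + \<omega>) * \<kappa>) \<le> 1 / (2 + U) * (1 / \<kappa>)"
    using assms \<kappa> by (simp add: frac_le mult_right_mono)
  ultimately have x: "1 / ((1 + \<omega>) * \<kappa>) \<le> x" by linarith
  have x0: "0 < x" by (rule less_le_trans[OF _ x]) (use \<kappa> \<omega> in simp)
  have "1 / x \<le> (1 + \<omega>) * \<kappa>" using divide_left_mono[OF x, of 1] x0 \<kappa> \<omega> by simp
  moreover have "1 + (1 + \<omega>) * \<kappa> \<le> 3 * \<omega> * \<kappa>"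
  proof -
    have "\<kappa> \<le> \<omega> * \<kappa>" using \<omega> \<kappa> by simp
    moreover have "1 + (1 + \<omega>) * \<kappa> = 1 + \<kappa> + \<omega> * \<kappa>" by (simp add: distrib_right)
    ultimately show ?thesis using \<kappa> by linarith
  qed
  moreover have "1 / (1 - exp (- x)) \<le> 1 + 1 / x"
  proof -
    have "exp (- x) \<le> 1 / (1 + x)"
      using exp_ge_add_one_self[of x] x0 by (simp add: exp_minus field_simps)
    then have "x / (1 + x) \<le> 1 - exp (- x)" using x0 by (simp add: field_simps)
    then have "1 / (1 - exp (- x)) \<le> 1 / (x / (1 + x))" using x0 by (intro divide_left_mono) auto
    also have "\<dots> = 1 + 1 / x" using x0 by (simp add: field_simps)
    finally show ?thesis .
  qed
  ultimately have geo: "1 / (1 - exp (- x)) \<le> 3 * \<omega> * \<kappa>" by linarith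
  have "(3 / 11 * sqrt \<nu>)\<^sup>2 \<le> \<mu>"
    using assms by (simp add: power_mult_distrib power2_eq_square)
  then have "3 / 11 * sqrt \<nu> \<le> sqrt \<mu>" by (rule real_le_rsqrt)
  then have root: "1 / sqrt \<mu> \<le> 1 / (3 / 11 * sqrt \<nu>)"
    using assms by (intro divide_left_mono) auto
  have "1 / (sqrt \<mu> * (1 - exp (- x))) = 1 / sqrt \<mu> * (1 / (1 - exp (- x)))" by simp
  also have "\<dots> \<le> 1 / (3 / 11 * sqrt \<nu>) * (3 * \<omega> * \<kappa>)"
    using root geo x0 assms by (intro mult_mono) auto
  also have "\<dots> = 11 * \<omega> * \<kappa> / sqrt \<nu>" by simp
  also have "\<dots> = exp (ln (11 * \<omega> * \<kappa>) - ln (sqrt \<nu>))"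
    using assms \<omega> \<kappa> by (simp add: exp_diff)
  also have "ln (sqrt \<nu>) = 1 / 2 * ln \<nu>" using assms by (simp add: ln_sqrt)
  finally show ?thesis by (simp add: x_def \<kappa>_def)
qed

text \<open>
  The excess mean of the Poisson comparison, with \<open>exp p - 1 \<le> (exp 1 - 1) * p\<close> on the unit interval
  by convexity.
\<close>

lemma sum_mult_exp_minus_one_le:
  fixes p :: "'a \<Rightarrow> real"
  assumes "\<And>j. j \<in> B \<Longrightarrow> 0 \<le> p j \<and> p j \<le> 1 \<and> p j \<le> q"
  shows "(\<Sum>j\<in>B. p j * (exp (p j) - 1)) \<le> 172 / 100 * q * (\<Sum>j\<in>B. p j)"
  unfolding sum_distrib_left
proof (intro sum_mono)
  fix j assume "j \<in> B"
  then have p: "0 \<le> p j" "p j \<le> 1" "p j \<le> q" using assms by auto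
  have "exp (p j) \<le> 1 + p j * (exp 1 - 1)"
    using convex_onD[OF exp_convex, of "p j" 0 1] p by (simp add: algebra_simps)
  then have "exp (p j) - 1 \<le> p j * (exp 1 - 1)" by simp
  also have "\<dots> \<le> q * (172 / 100)" using p e_less_272 by (intro mult_mono) auto
  finally have "p j * (exp (p j) - 1) \<le> p j * (q * (172 / 100))" using p by (intro mult_left_mono) auto
  then show "p j * (exp (p j) - 1) \<le> 172 / 100 * q * p j" by (simp add: mult_ac)
qed

section \<open>Reaching the information\<close>

text \<open>
  The prefactor of the sharp bound degenerates as \<open>s\<close> tends to 0, so the bound is available only for
  tilts bounded away from 0.  This loses nothing: each summand increases on \<open>{0..s\<^sub>0}\<close>, so the
  supremum can be taken over \<open>{s\<^sub>0..<1}\<close>, and no maximiser has to be located.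
\<close>

lemma info_le:
  fixes \<Lambda> :: "real^'l::finite^'k::finite"
  assumes pos: "\<And>k l. 0 < \<Lambda> $ k $ l" and s\<^sub>0: "0 < s\<^sub>0" "s\<^sub>0 < 1"
    and small: "\<And>l. s\<^sub>0 \<le> 1 / (2 + \<bar>ln (\<Lambda> $ r $ l / \<Lambda> $ k $ l)\<bar>)"
    and bound: "\<And>s. s\<^sub>0 \<le> s \<Longrightarrow> s < 1 \<Longrightarrow>
      (\<Sum>l\<in>UNIV. (1 - s) * \<Lambda> $ k $ l + s * \<Lambda> $ r $ l
        - (\<Lambda> $ k $ l) powr (1 - s) * (\<Lambda> $ r $ l) powr s) \<le> c"
  shows "info \<Lambda> k r \<le> c"
  unfolding info_def
proof (rule cSUP_least)
  fix s :: real assume s: "s \<in> {0<..<1}"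
  let ?f = "\<lambda>s. \<Sum>l\<in>UNIV. (1 - s) * \<Lambda> $ k $ l + s * \<Lambda> $ r $ l
        - (\<Lambda> $ k $ l) powr (1 - s) * (\<Lambda> $ r $ l) powr s"
  show "?f s \<le> c"
  proof (cases "s\<^sub>0 \<le> s")
    case False
    then have "?f s \<le> ?f s\<^sub>0"
      using s pos small by (intro sum_mono chernoff_term_mono) auto
    also have "\<dots> \<le> c" using s\<^sub>0 by (intro bound) auto
    finally show ?thesis .
  qed (use s in \<open>auto intro: bound\<close>)
qed simp

lemma info_le_all:
  assumes "\<And>s. 0 < s \<Longrightarrow> s < 1 \<Longrightarrow>
      (\<Sum>l\<in>UNIV. (1 - s) * \<Lambda> $ k $ l + s * \<Lambda> $ r $ l
        - (\<Lambda> $ k $ l) powr (1 - s) * (\<Lambda> $ r $ l) powr s) \<le> c"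
  shows "info \<Lambda> k r \<le> c"
  unfolding info_def by (rule cSUP_least) (use assms in auto)

lemma le_exp_minus_infoI:
  assumes "0 < p \<Longrightarrow> info \<Lambda> k r \<le> \<eta> - ln p"
  shows "p \<le> exp (- info \<Lambda> k r + \<eta>)"
proof (cases "0 < p")
  case True
  then have "ln p \<le> - info \<Lambda> k r + \<eta>" using assms by simp
  then show ?thesis using True by (metis exp_le_cancel_iff exp_ln)
next
  case False
  then show ?thesis using exp_ge_zero order_trans linear not_less by metis
qed

text \<open>
  The exponent of the Chernoff bound is, up to the perturbation \<open>5 * \<rho> * m + 3 * \<Delta>\<close> per column cluster,
  the negative of the function whose supremum over \<open>s\<close> is \<^const>\<open>info\<close>.
\<close>

lemma sum_columns_exponent_le:
  fixes p :: "'m::finite \<Rightarrow> real" and a b :: "'l::finite \<Rightarrow> real" and zt :: "'m \<Rightarrow> 'l"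
    and m \<rho> \<Delta> s :: real
  assumes ab: "\<And>l. 0 < a l" "\<And>l. 0 < b l" "\<And>l. a l \<le> m" "\<And>l. b l \<le> m"
    and \<rho>: "0 \<le> \<rho>" "3 * \<rho> \<le> 1" and s: "0 < s" "s < 1"
    and \<Delta>: "\<And>l. \<bar>(\<Sum>j | zt j = l. p j) - a l\<bar> \<le> \<Delta>" "\<And>l. \<Delta> \<le> \<rho> * a l"
  shows "s * (\<Sum>l\<in>UNIV. a l - b l + 2 * \<Delta>)
      + (\<Sum>j\<in>UNIV. p j * (exp (s * ln ((1 + \<rho>) / (1 - \<rho>) * (b (zt j) / a (zt j)))) - 1))
    \<le> - (\<Sum>l\<in>UNIV. (1 - s) * a l + s * b l - a l powr (1 - s) * b l powr s)
      + CARD('l) * (5 * \<rho> * m + 3 * \<Delta>)"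
proof -
  let ?T = "\<lambda>l. exp (s * ln ((1 + \<rho>) / (1 - \<rho>) * (b l / a l)))"
  have "(\<Sum>j\<in>UNIV. p j * (?T (zt j) - 1)) = (\<Sum>l\<in>UNIV. \<Sum>j | zt j = l. p j * (?T (zt j) - 1))"
    using sum.group[of UNIV UNIV zt "\<lambda>j. p j * (?T (zt j) - 1)"] by simp
  also have "\<dots> = (\<Sum>l\<in>UNIV. (\<Sum>j | zt j = l. p j) * (?T l - 1))"
    by (simp add: sum_distrib_right)
  finally have "s * (\<Sum>l\<in>UNIV. a l - b l + 2 * \<Delta>) + (\<Sum>j\<in>UNIV. p j * (?T (zt j) - 1))
    = (\<Sum>l\<in>UNIV. s * (a l - b l + 2 * \<Delta>) + (\<Sum>j | zt j = l. p j) * (?T l - 1))"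
    by (simp only: sum_distrib_left[of s] sum.distrib[symmetric])
  also have "\<dots> \<le> (\<Sum>l\<in>UNIV. - ((1 - s) * a l + s * b l - a l powr (1 - s) * b l powr s)
      + (5 * \<rho> * m + 3 * \<Delta>))"
    using assms by (intro sum_mono tilted_exponent_le) auto
  also have "\<dots> = - (\<Sum>l\<in>UNIV. (1 - s) * a l + s * b l - a l powr (1 - s) * b l powr s)
      + CARD('l) * (5 * \<rho> * m + 3 * \<Delta>)"
    by (simp only: sum.distrib sum_negf) (simp add: distrib_left)
  finally show ?thesis .
qed

text \<open>
  In logarithmic form the separation \<^const>\<open>eps_sep\<close> is the largest absolute log-ratio, so it both
  supplies the block on which the count is sharp and limits how small a tilt can be critical.
\<close>

lemma
  fixes \<Lambda> :: "real^'l::finite^'k::finite"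
  assumes pos: "\<And>k l. 0 < \<Lambda> $ k $ l"
  shows eps_sep_attained: "\<exists>l. \<bar>ln (\<Lambda> $ r $ l / \<Lambda> $ k $ l)\<bar> = ln (1 + eps_sep \<Lambda> k r)"
    and abs_log_ratio_le: "\<bar>ln (\<Lambda> $ r $ l / \<Lambda> $ k $ l)\<bar> \<le> ln (1 + eps_sep \<Lambda> k r)"
    and eps_sep_nonneg: "0 \<le> eps_sep \<Lambda> k r"
    and eps_sep_le: "1 + eps_sep \<Lambda> k r \<le> max_norm \<Lambda> / min_entry \<Lambda>"
proof -
  let ?q = "\<lambda>l. max (\<Lambda> $ k $ l / \<Lambda> $ r $ l) (\<Lambda> $ r $ l / \<Lambda> $ k $ l)"
  have abs_ln: "\<bar>ln (\<Lambda> $ r $ l / \<Lambda> $ k $ l)\<bar> = ln (?q l)" for l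
  proof -
    have p: "0 < \<Lambda> $ k $ l" "0 < \<Lambda> $ r $ l" using pos by auto
    show ?thesis
    proof (cases "\<Lambda> $ k $ l \<le> \<Lambda> $ r $ l")
      case True
      then have "\<Lambda> $ k $ l / \<Lambda> $ r $ l \<le> 1" "1 \<le> \<Lambda> $ r $ l / \<Lambda> $ k $ l" using p by auto
      then show ?thesis by (simp add: max_def)
    next
      case False
      then have le: "\<Lambda> $ r $ l / \<Lambda> $ k $ l \<le> 1" "1 \<le> \<Lambda> $ k $ l / \<Lambda> $ r $ l" using p by auto
      then have "?q l = \<Lambda> $ k $ l / \<Lambda> $ r $ l" by (simp add: max_def)
      moreover have "ln (\<Lambda> $ r $ l / \<Lambda> $ k $ l) \<le> 0" using le p by (simp add: ln_le_zero_iff)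
      ultimately show ?thesis using p by (simp add: ln_div)
    qed
  qed
  have q1: "1 \<le> ?q l" for l using pos[of k l] pos[of r l] by (simp add: le_max_iff_disj) linarith
  have max: "1 + eps_sep \<Lambda> k r = Max (range ?q)" by (simp add: eps_sep_def)
  have le: "?q l \<le> 1 + eps_sep \<Lambda> k r" for l unfolding max by (intro Max_ge) auto
  have "1 + eps_sep \<Lambda> k r \<in> range ?q" unfolding max by (intro Max_in) auto
  then obtain l0 where l0: "1 + eps_sep \<Lambda> k r = ?q l0" by blast
  then show "\<exists>l. \<bar>ln (\<Lambda> $ r $ l / \<Lambda> $ k $ l)\<bar> = ln (1 + eps_sep \<Lambda> k r)" using abs_ln by metis
  show "\<bar>ln (\<Lambda> $ r $ l / \<Lambda> $ k $ l)\<bar> \<le> ln (1 + eps_sep \<Lambda> k r)"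
    unfolding abs_ln using le[of l] q1[of l] by (subst ln_le_cancel_iff) auto
  show "0 \<le> eps_sep \<Lambda> k r" using q1[of l0] l0 by linarith
  have "min_entry \<Lambda> \<in> {\<Lambda> $ k $ l | k l. True}"
  proof -
    have "{\<Lambda> $ k $ l | k l. True} = range (\<lambda>(k, l). \<Lambda> $ k $ l)" by auto
    then show ?thesis unfolding min_entry_def by (intro Min_in) auto
  qed
  then have "0 < min_entry \<Lambda>" using pos by auto
  then have "\<Lambda> $ k1 $ l / \<Lambda> $ k2 $ l \<le> max_norm \<Lambda> / min_entry \<Lambda>" for k1 k2 l
    using pos[of k1 l] abs_entry_le_max_norm[of \<Lambda> k1 l] min_entry_le[of \<Lambda> k2 l]
    by (intro frac_le) auto
  then show "1 + eps_sep \<Lambda> k r \<le> max_norm \<Lambda> / min_entry \<Lambda>" unfolding l0 by simp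
qed

section \<open>The misclassification bound\<close>

theorem lemma2:
  fixes M :: "'w measure"
    and A :: "'n::finite \<Rightarrow> 'm::finite \<Rightarrow> 'w \<Rightarrow> bool"
    and y :: "'n \<Rightarrow> 'k::finite" and z zt :: "'m \<Rightarrow> 'l::finite"
    and P \<Lambda> :: "real^'l^'k" and \<Gamma> :: "real^'k^'l"
    and \<omega> \<beta> \<delta> :: real
  assumes "sbm M A y z P"
    and "\<Lambda> = Lambda_mat z P" and "\<Gamma> = Gamma_mat y P"
    and "0 < min_entry \<Lambda>" and "0 < min_entry \<Gamma>"
    and "max (max_norm \<Lambda> / min_entry \<Lambda>) (max_norm \<Gamma> / min_entry \<Gamma>) \<le> \<omega>"
    and "\<forall>k. 1 / (\<beta> * real CARD('k)) \<le> cluster_prop y k \<and> cluster_prop y k \<le> \<beta> / real CARD('k)"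
    and "\<forall>l. 1 / (\<beta> * real CARD('l)) \<le> cluster_prop z l \<and> cluster_prop z l \<le> \<beta> / real CARD('l)"
    and "row_mean_mat M A y zt \<in> mat_ball \<Lambda> \<delta>"
    and "3 * \<omega> * \<delta> < 1"
  shows "\<forall>k r i. k \<noteq> r \<longrightarrow> y i = k \<longrightarrow>
      \<P>(w in M. \<exists>X\<in>mat_ball \<Lambda> \<delta>. Y_stat k r (block_sums A zt i w) X \<ge> 0)
        \<le> exp (- info \<Lambda> k r + 8 * \<omega> * \<delta> * real CARD('l) * max_norm \<Lambda>)
      \<and> (eps_sep \<Lambda> k r - 2 * \<omega> * (1 + eps_sep \<Lambda> k r) * \<delta> > 0 \<longrightarrow>
          \<P>(w in M. \<exists>X\<in>mat_ball \<Lambda> \<delta>. Y_stat k r (block_sums A zt i w) X \<ge> 0)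
            \<le> exp (- info \<Lambda> k r
                + (21 * \<delta> * \<omega> * real CARD('l) * max_norm \<Lambda>
                   + 5 * \<beta> * (real CARD('l))\<^sup>2 * (max_norm \<Lambda>)\<^sup>2 / real CARD('m)
                   + ln (11 * \<omega> *
                       (1 / (eps_sep \<Lambda> k r - 2 * \<omega> * (1 + eps_sep \<Lambda> k r) * \<delta>) + 1))
                   - 1 / 2 * ln (min_entry \<Lambda>))))"
proof (intro allI impI)
  fix k r i assume "k \<noteq> r" and k: "y i = k"
  define m where "m = max_norm \<Lambda>"
  define \<Delta> where "\<Delta> = \<delta> * m"
  define \<rho> where "\<rho> = \<omega> * \<delta>"
  define p where "p j = P $ k $ z j" for j
  define a where "a l = \<Lambda> $ k $ l" for l
  define b where "b l = \<Lambda> $ r $ l" for l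
  define f where "f s = (\<Sum>l\<in>UNIV. (1 - s) * a l + s * b l - a l powr (1 - s) * b l powr s)" for s
  define d where "d = (\<Sum>l\<in>UNIV. a l - b l + 2 * \<Delta>)"
  define \<theta> where "\<theta> l = ln ((1 + \<rho>) / (1 - \<rho>) * (b l / a l))" for l
  define prob where "prob = \<P>(w in M. \<exists>X\<in>mat_ball \<Lambda> \<delta>. Y_stat k r (block_sums A zt i w) X \<ge> 0)"

  have low: "min_entry \<Lambda> \<le> \<Lambda> $ k $ l" and pos: "0 < \<Lambda> $ k $ l" for k l
    using min_entry_le[of \<Lambda> k l] assms(4) by simp_all
  have up: "\<Lambda> $ k $ l \<le> m" for k l
    using abs_entry_le_max_norm[of \<Lambda> k l] by (simp add: m_def)
  have m0: "0 < m" using up[of k undefined] pos[of k undefined] by linarith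
  have ratio: "m / min_entry \<Lambda> \<le> \<omega>" using assms(6) by (simp add: m_def)
  then have m_le: "m \<le> \<omega> * min_entry \<Lambda>" using assms(4) by (simp add: pos_divide_le_eq)
  have \<omega>: "1 \<le> \<omega>"
  proof -
    have "min_entry \<Lambda> \<le> m" using low[of k undefined] up[of k undefined] by linarith
    then have "1 \<le> m / min_entry \<Lambda>" using assms(4) by simp
    then show ?thesis using ratio by linarith
  qed
  have mean: "\<bar>(\<Sum>j | zt j = l. p j) - a l\<bar> \<le> \<Delta>" for l
    using assms(9) abs_entry_le_max_norm[of "row_mean_mat M A y zt - \<Lambda>" k l]
      sbm_row_mean[OF assms(1), of zt i l]
    by (simp add: mat_ball_def k p_def a_def \<Delta>_def m_def)
  have \<Delta>0: "0 \<le> \<Delta>" using mean[of undefined] by linarith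
  then have \<delta>: "0 \<le> \<delta>" using m0 by (simp add: \<Delta>_def zero_le_mult_iff)
  have \<rho>: "0 \<le> \<rho>" "3 * \<rho> \<le> 1" "\<rho> < 1" using \<delta> \<omega> assms(10) by (auto simp: \<rho>_def)
  have \<Delta>_le: "\<Delta> \<le> \<rho> * \<Lambda> $ k $ l" for k l
  proof -
    have "\<Delta> \<le> \<delta> * (\<omega> * min_entry \<Lambda>)" unfolding \<Delta>_def using m_le \<delta> by (rule mult_left_mono)
    also have "\<dots> \<le> \<delta> * (\<omega> * \<Lambda> $ k $ l)" using low \<delta> \<omega> by (intro mult_left_mono) auto
    finally show ?thesis by (simp add: \<rho>_def mult_ac)
  qed
  have p: "0 \<le> p j" "p j \<le> 1" for j using sbmD(5,6)[OF assms(1)] by (auto simp: p_def)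

  have prob_le: "prob \<le> (\<Sum>S | S \<subseteq> UNIV \<and> 0 \<le> (\<Sum>j\<in>S. \<theta> (zt j)) + d. bernoulli_weight p UNIV S)"
    using misclassification_prob_le[OF assms(1) pos \<Delta>_le[unfolded \<Delta>_def m_def] \<rho>(1,3)]
    unfolding prob_def \<theta>_def d_def a_def b_def p_def k[symmetric] \<Delta>_def m_def .
  have exponent: "s * d + (\<Sum>j\<in>UNIV. p j * (exp (s * \<theta> (zt j)) - 1))
      \<le> - f s + 8 * \<omega> * \<delta> * CARD('l) * m" if s: "0 < s" "s < 1" for s
  proof -
    have "s * d + (\<Sum>j\<in>UNIV. p j * (exp (s * \<theta> (zt j)) - 1))
      \<le> - f s + CARD('l) * (5 * \<rho> * m + 3 * \<Delta>)"
      unfolding d_def f_def \<theta>_def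
      by (rule sum_columns_exponent_le)
        (use pos up \<rho> s mean \<Delta>_le in \<open>auto simp: a_def b_def\<close>)
    also have "5 * \<rho> * m + 3 * \<Delta> \<le> 8 * (\<rho> * m)"
      using mult_right_mono[OF \<omega> \<Delta>0] by (simp add: \<rho>_def \<Delta>_def mult_ac)
    finally show ?thesis by (simp add: \<rho>_def mult_ac mult_left_mono)
  qed

  show "\<P>(w in M. \<exists>X\<in>mat_ball \<Lambda> \<delta>. Y_stat k r (block_sums A zt i w) X \<ge> 0)
        \<le> exp (- info \<Lambda> k r + 8 * \<omega> * \<delta> * real CARD('l) * max_norm \<Lambda>)
      \<and> (eps_sep \<Lambda> k r - 2 * \<omega> * (1 + eps_sep \<Lambda> k r) * \<delta> > 0 \<longrightarrow>
          \<P>(w in M. \<exists>X\<in>mat_ball \<Lambda> \<delta>. Y_stat k r (block_sums A zt i w) X \<ge> 0)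
            \<le> exp (- info \<Lambda> k r
                + (21 * \<delta> * \<omega> * real CARD('l) * max_norm \<Lambda>
                   + 5 * \<beta> * (real CARD('l))\<^sup>2 * (max_norm \<Lambda>)\<^sup>2 / real CARD('m)
                   + ln (11 * \<omega> *
                       (1 / (eps_sep \<Lambda> k r - 2 * \<omega> * (1 + eps_sep \<Lambda> k r) * \<delta>) + 1))
                   - 1 / 2 * ln (min_entry \<Lambda>))))"
    unfolding prob_def[symmetric] m_def[symmetric]
  proof (intro conjI impI)
    show "prob \<le> exp (- info \<Lambda> k r + 8 * \<omega> * \<delta> * real CARD('l) * m)"
    proof (rule le_exp_minus_infoI, rule info_le_all)
      fix s :: real assume pr: "0 < prob" and s: "0 < s" "s < 1"
      have "prob \<le> exp (s * d + (\<Sum>j\<in>UNIV. p j * (exp (s * \<theta> (zt j)) - 1)))"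
        using prob_le bernoulli_chernoff[of UNIV p s "\<lambda>j. \<theta> (zt j)" d] p s by fastforce
      also have "\<dots> \<le> exp (- f s + 8 * \<omega> * \<delta> * CARD('l) * m)"
        using exponent[OF s] by simp
      finally have "ln prob \<le> - f s + 8 * \<omega> * \<delta> * CARD('l) * m"
        using pr by (metis exp_le_cancel_iff exp_ln)
      then show "(\<Sum>l\<in>UNIV. (1 - s) * \<Lambda> $ k $ l + s * \<Lambda> $ r $ l
          - (\<Lambda> $ k $ l) powr (1 - s) * (\<Lambda> $ r $ l) powr s)
        \<le> 8 * \<omega> * \<delta> * real CARD('l) * m - ln prob"
        by (simp add: f_def a_def b_def)
    qed
  next
    define \<epsilon> where "\<epsilon> = eps_sep \<Lambda> k r"
    define \<epsilon>' where "\<epsilon>' = \<epsilon> - 2 * \<omega> * (1 + \<epsilon>) * \<delta>"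
    assume "0 < eps_sep \<Lambda> k r - 2 * \<omega> * (1 + eps_sep \<Lambda> k r) * \<delta>"
    then have \<epsilon>': "0 < \<epsilon>'" by (simp add: \<epsilon>'_def \<epsilon>_def)
    have \<epsilon>: "0 \<le> \<epsilon>" unfolding \<epsilon>_def using pos by (rule eps_sep_nonneg)
    define U where "U = ln (1 + \<epsilon>)"
    define s\<^sub>0 where "s\<^sub>0 = 1 / (2 + U)"
    have U: "0 \<le> U" using \<epsilon> by (simp add: U_def)
    have "U \<le> \<epsilon>" unfolding U_def using \<epsilon> by (rule ln_add_one_self_le_self)
    moreover have "1 + \<epsilon> \<le> m / min_entry \<Lambda>" unfolding \<epsilon>_def m_def using pos by (rule eps_sep_le)
    ultimately have U\<omega>: "U \<le> \<omega> - 1" using ratio by linarith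
    have s\<^sub>0: "0 < s\<^sub>0" "s\<^sub>0 < 1" using U by (auto simp: s\<^sub>0_def)
    obtain l\<^sub>0 where l\<^sub>0: "\<bar>ln (b l\<^sub>0 / a l\<^sub>0)\<bar> = U"
      using eps_sep_attained[of \<Lambda> r k, OF pos] by (auto simp: U_def \<epsilon>_def a_def b_def)
    define B where "B = {j. zt j = l\<^sub>0}"

    \<comment> \<open>In the worst case the inflation of the ratio works against the separation; the identity
      \<open>1 + \<epsilon>' = (1 + \<epsilon>) * (1 - 2 * \<rho>)\<close> explains the form of the hypothesis.\<close>
    have \<theta>: "ln (1 + \<epsilon>') \<le> \<bar>\<theta> l\<^sub>0\<bar>"
    proof -
      have "1 + \<epsilon>' = (1 + \<epsilon>) * (1 - 2 * \<rho>)" by (simp add: \<epsilon>'_def \<rho>_def algebra_simps)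
      also have "\<dots> \<le> (1 + \<epsilon>) * ((1 - \<rho>) / (1 + \<rho>))"
      proof (intro mult_left_mono)
        have "(1 - 2 * \<rho>) * (1 + \<rho>) \<le> 1 - \<rho>" by (simp add: algebra_simps)
        then show "1 - 2 * \<rho> \<le> (1 - \<rho>) / (1 + \<rho>)" using \<rho> by (simp add: pos_le_divide_eq)
      qed (use \<epsilon> in simp)
      finally have "ln (1 + \<epsilon>') \<le> ln ((1 + \<epsilon>) * ((1 - \<rho>) / (1 + \<rho>)))"
        using \<epsilon>' \<rho> \<epsilon> by (subst ln_le_cancel_iff) auto
      also have "\<dots> = U - ln ((1 + \<rho>) / (1 - \<rho>))"
        using \<rho> \<epsilon> by (simp add: U_def ln_mult ln_div)
      also have "\<dots> \<le> \<bar>ln ((1 + \<rho>) / (1 - \<rho>)) + ln (b l\<^sub>0 / a l\<^sub>0)\<bar>"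
      proof -
        have "1 \<le> (1 + \<rho>) / (1 - \<rho>)" using \<rho> by (simp add: pos_le_divide_eq)
        then have "0 \<le> ln ((1 + \<rho>) / (1 - \<rho>))" by simp
        then show ?thesis using l\<^sub>0 by linarith
      qed
      also have "\<dots> = \<bar>\<theta> l\<^sub>0\<bar>"
        using \<rho> pos[of k l\<^sub>0] pos[of r l\<^sub>0] unfolding \<theta>_def a_def b_def
        by (subst ln_mult_pos) auto
      finally show ?thesis .
    qed
    then have \<theta>0: "\<theta> l\<^sub>0 \<noteq> 0" using \<epsilon>' ln_gt_zero[of "1 + \<epsilon>'"] by auto

    \<comment> \<open>A column cluster of at least \<open>CARD('m) / (\<beta> * CARD('l))\<close> elements spreads its mean, at most
      \<open>m\<close>, over many columns, so each success probability is at most \<open>q\<close>.\<close>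
    define q where "q = \<beta> * CARD('l) * m / CARD('m)"
    have \<beta>: "0 < \<beta>"
    proof -
      have "cluster_size z l\<^sub>0 \<noteq> 0" using pos[of k l\<^sub>0] by (intro notI) (simp add: assms(2) Lambda_mat_def)
      then have "0 < cluster_prop z l\<^sub>0" by (simp add: cluster_prop_def)
      also have "\<dots> \<le> \<beta> / CARD('l)" using assms(8) by simp
      finally show ?thesis by (simp add: zero_less_divide_iff)
    qed
    have q: "p j \<le> q" for j
    proof -
      have "CARD('m) / (\<beta> * CARD('l)) \<le> cluster_size z (z j)"
        using assms(8)[rule_format, of "z j"] by (simp add: cluster_prop_def pos_le_divide_eq)
      then have "p j * (CARD('m) / (\<beta> * CARD('l))) \<le> p j * cluster_size z (z j)"
        using p by (intro mult_left_mono) auto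
      also have "\<dots> = \<Lambda> $ k $ z j" by (simp add: assms(2) Lambda_mat_def p_def)
      also have "\<dots> \<le> m" by (rule up)
      finally show ?thesis using \<beta> by (simp add: q_def field_simps)
    qed

    show "prob \<le> exp (- info \<Lambda> k r + (21 * \<delta> * \<omega> * real CARD('l) * m
        + 5 * \<beta> * (real CARD('l))\<^sup>2 * m\<^sup>2 / real CARD('m)
        + ln (11 * \<omega> * (1 / (eps_sep \<Lambda> k r - 2 * \<omega> * (1 + eps_sep \<Lambda> k r) * \<delta>) + 1))
        - 1 / 2 * ln (min_entry \<Lambda>)))" (is "prob \<le> exp (- info \<Lambda> k r + ?\<eta>)")
    proof (rule le_exp_minus_infoI, rule info_le[OF pos s\<^sub>0])
      fix l
      show "s\<^sub>0 \<le> 1 / (2 + \<bar>ln (\<Lambda> $ r $ l / \<Lambda> $ k $ l)\<bar>)"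
        unfolding s\<^sub>0_def U_def \<epsilon>_def
        using abs_log_ratio_le[of \<Lambda> r l k, OF pos] by (intro divide_left_mono) auto
    next
      fix s :: real assume pr: "0 < prob" and s: "s\<^sub>0 \<le> s" "s < 1"
      have s0: "0 < s" using s s\<^sub>0 by linarith
      define T where "T = exp (s * \<theta> l\<^sub>0)"
      define a' where "a' = (\<Sum>j\<in>B. p j)"
      define \<mu> where "\<mu> = (\<Sum>j\<in>B. p j * exp (p j)) * T"
      have ab: "0 < a l\<^sub>0" "0 < b l\<^sub>0" "a l\<^sub>0 \<le> m" "b l\<^sub>0 \<le> m" using pos up by (auto simp: a_def b_def)
      have T: "0 < T" "a l\<^sub>0 * T \<le> 2 * m" "min (a l\<^sub>0) (b l\<^sub>0) \<le> a l\<^sub>0 * T"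
        using tilted_mean_bounds(2,3)[OF ab \<rho>(1,2) s0 s(2)] by (auto simp: T_def \<theta>_def)
      have a': "(1 - \<rho>) * a l\<^sub>0 \<le> a'" "a' \<le> (1 + \<rho>) * a l\<^sub>0"
        using mean[of l\<^sub>0] \<Delta>_le[of k l\<^sub>0] by (auto simp: a'_def B_def a_def algebra_simps)

      have \<mu>_low: "2 / 3 * min_entry \<Lambda> \<le> \<mu>"
      proof -
        have "2 / 3 * min_entry \<Lambda> \<le> (1 - \<rho>) * (a l\<^sub>0 * T)"
          using \<rho> T(3) low[of k l\<^sub>0] low[of r l\<^sub>0] assms(4)
          by (intro mult_mono) (auto simp: a_def b_def)
        also have "\<dots> = (1 - \<rho>) * a l\<^sub>0 * T" by simp
        also have "\<dots> \<le> a' * T" using a' T by (intro mult_right_mono) auto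
        also have "\<dots> \<le> \<mu>"
          unfolding \<mu>_def a'_def using p T
          by (intro mult_right_mono sum_mono) (auto simp: mult_le_cancel_left1)
        finally show ?thesis .
      qed
      have \<mu>_up: "\<mu> - a' * T \<le> 5 * \<beta> * (real CARD('l))\<^sup>2 * m\<^sup>2 / real CARD('m)"
      proof -
        have q0: "0 \<le> q" using \<beta> m0 by (simp add: q_def)
        have "\<mu> - a' * T = (\<Sum>j\<in>B. p j * (exp (p j) - 1)) * T"
          by (simp add: \<mu>_def a'_def left_diff_distrib right_diff_distrib sum_subtractf)
        also have "\<dots> \<le> 172 / 100 * q * a' * T"
          unfolding a'_def using p q T by (intro mult_right_mono sum_mult_exp_minus_one_le) auto
        \<comment> \<open>The tilt is large only where the mean is small: \<open>a' * T\<close> is at most \<open>8 / 3 * m\<close>, and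
          \<open>1.72 * 8 / 3 < 5\<close>.\<close>
        also have "\<dots> = 172 / 100 * q * (a' * T)" by simp
        also have "\<dots> \<le> 172 / 100 * q * (4 / 3 * (2 * m))"
        proof (intro mult_left_mono)
          have "a' * T \<le> (1 + \<rho>) * a l\<^sub>0 * T" using a' T by (intro mult_right_mono) auto
          also have "\<dots> = (1 + \<rho>) * (a l\<^sub>0 * T)" by simp
          also have "\<dots> \<le> 4 / 3 * (2 * m)" using \<rho> T ab by (intro mult_mono[OF _ T(2)]) auto
          finally show "a' * T \<le> 4 / 3 * (2 * m)" .
        qed (use q0 in auto)
        also have "\<dots> \<le> 5 * (q * m)" using q0 m0 by simp
        also have "\<dots> \<le> 5 * (q * m) * CARD('l)"
          using mult_left_mono[of 1 "CARD('l)" "5 * (q * m)"] q0 m0 by simp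
        also have "\<dots> = 5 * \<beta> * (real CARD('l))\<^sup>2 * m\<^sup>2 / real CARD('m)"
          by (simp add: q_def power2_eq_square)
        finally show ?thesis .
      qed

      have "prob \<le> exp (s * d + (\<Sum>j\<in>UNIV. p j * (exp (s * \<theta> (zt j)) - 1)))
          * exp (\<mu> - a' * T) / (sqrt \<mu> * (1 - exp (- (s * \<bar>\<theta> l\<^sub>0\<bar>))))"
      proof (rule order_trans[OF prob_le])
        show "(\<Sum>S | S \<subseteq> UNIV \<and> 0 \<le> (\<Sum>j\<in>S. \<theta> (zt j)) + d. bernoulli_weight p UNIV S)
          \<le> exp (s * d + (\<Sum>j\<in>UNIV. p j * (exp (s * \<theta> (zt j)) - 1)))
          * exp (\<mu> - a' * T) / (sqrt \<mu> * (1 - exp (- (s * \<bar>\<theta> l\<^sub>0\<bar>))))"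
          unfolding \<mu>_def a'_def T_def
          by (rule bernoulli_sharp_chernoff)
            (use p s0 \<theta>0 \<mu>_low assms(4) in \<open>auto simp: B_def \<mu>_def T_def\<close>)
      qed
      also have "\<dots> = exp (s * d + (\<Sum>j\<in>UNIV. p j * (exp (s * \<theta> (zt j)) - 1)))
          * exp (\<mu> - a' * T) * (1 / (sqrt \<mu> * (1 - exp (- (s * \<bar>\<theta> l\<^sub>0\<bar>)))))" by simp
      also have "\<dots> \<le> exp (- f s + 8 * \<omega> * \<delta> * CARD('l) * m)
          * exp (5 * \<beta> * (real CARD('l))\<^sup>2 * m\<^sup>2 / real CARD('m))
          * exp (ln (11 * \<omega> * (1 / \<epsilon>' + 1)) - 1 / 2 * ln (min_entry \<Lambda>))"
        using exponent[OF s0 s(2)] \<mu>_up s0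
          sharp_factor_le[OF assms(4) \<mu>_low \<epsilon>' \<theta> U U\<omega> s(1)[unfolded s\<^sub>0_def]]
          \<mu>_low assms(4)
        by (intro mult_mono) auto
      also have "\<dots> \<le> exp (- f s + ?\<eta>)"
      proof -
        have "8 * \<omega> * \<delta> * CARD('l) * m \<le> 21 * \<delta> * \<omega> * CARD('l) * m"
          using \<omega> \<delta> m0 by (simp add: mult_ac mult_left_mono)
        then show ?thesis by (simp add: \<epsilon>'_def \<epsilon>_def flip: exp_add)
      qed
      finally have "ln prob \<le> - f s + ?\<eta>"
        using pr by (metis exp_le_cancel_iff exp_ln)
      then show "(\<Sum>l\<in>UNIV. (1 - s) * \<Lambda> $ k $ l + s * \<Lambda> $ r $ l
          - (\<Lambda> $ k $ l) powr (1 - s) * (\<Lambda> $ r $ l) powr s) \<le> ?\<eta> - ln prob"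
        by (simp add: f_def a_def b_def)
    qed
  qed
qed

end
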